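(* Let $(\varphi_t)_{t\ge 0}$ be a non-elliptic semigroup in $\mathbb{D}$ with Denjoy–Wolff point $\tau\in\partial\mathbb{D}$ and Koenigs function $h$. Let $\Omega:=h(\mathbb{D})$. If for some $p\in\mathsf{NP}(\Omega)$ the limits $$\alpha^-(p):=\lim_{t\to+\infty}\alpha^-_{\Omega,p}(t)\quad\text{and}\quad \alpha^+(p):=\lim_{t\to+\infty}\alpha^+_{\Omega,p}(t)$$ exist and satisfy $\alpha^-(p)>0$ and $\alpha^+(p)>0$, then for every $z\in\mathbb{D}$, $$\mathrm{Slope}[t\mapsto\varphi_t(z),\tau]=\big\{\eta\tfrac{\pi}{2}\big\},\qquad \eta:=\frac{\alpha^-(p)-\alpha^+(p)}{\alpha^-(p)+\alpha^+(p)}.$$ In particular, every trajectory $t\mapsto\varphi_t(z)$ converges to $\tau$ as $t\to+\infty$ non-tangentially and with a definite slope.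
   Context: $\mathbb{D}$ is the open unit disk in $\mathbb{C}$. A semigroup in $\mathbb{D}$ is a family $(\varphi_t)_{t\ge0}$ of holomorphic maps $\varphi_t:\mathbb{D}\to\mathbb{D}$ with $\varphi_0=\mathrm{id}$, $\varphi_{s+t}=\varphi_s\circ\varphi_t$ for all $s,t\ge0$, and $t\mapsto\varphi_t$ continuous for the topology of uniform convergence on compacta. It is non-elliptic if no $\varphi_t$ with $t>0$ has a fixed point in $\mathbb{D}$; then there is a unique $\tau\in\partial\mathbb{D}$, the Denjoy–Wolff point (DW-point), with $\varphi_t(z)\to\tau$ as $t\to+\infty$ for all $z\in\mathbb{D}$. A Koenigs function of a non-elliptic semigroup is a univalent holomorphic map $h:\mathbb{D}\to\mathbb{C}$ such that $h(\varphi_t(z))=h(z)+it$ for all $z\in\mathbb{D}$, $t\ge0$; it exists and is unique up to an additive constant. The image $\Omega=h(\mathbb{D})$ is called the planar domain of the semigroup. It is starlike at infinity, i.e. $\Omega+it\subset\Omega$ for all $t\ge0$. Slope set: for $z\in\mathbb{D}$, $\mathrm{Slope}[t\mapsto\varphi_t(z),\tau]$ is the set of all $\theta\in[-\pi/2,\pi/2]$ for which there is a sequence $t_n\to+\infty$ with $\mathrm{Arg}(1-\overline{\tau}\varphi_{t_n}(z))\to\theta$, where $\mathrm{Arg}$ takes values in $(-\pi/2,\pi/2)$ here. Convergence is non-tangential if the slope set is a compact subset of $(-\pi/2,\pi/2)$; it is with a definite slope if the slope set is a singleton. For a domain $\Omega\subset\mathbb{C}$ starlike at infinity, $\mathsf{NP}(\Omega)$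 (natural points) is the set of $p\in\mathbb{C}$ such that for some $t_0\ge0$, $p+it\in\Omega$ for all $t>t_0$. For $p\in\mathsf{NP}(\Omega)$ and $t>0$ with $p+it\in\Omega$, the left and right angular extents are $$\alpha^-_{\Omega,p}(t):=\min\{\pi,\ \sup\{\alpha>0: p+ite^{i\theta}\in\Omega\ \text{for all}\ \theta\in[0,\alpha]\}\},$$ $$\alpha^+_{\Omega,p}(t):=\min\{\pi,\ \sup\{\alpha>0: p+ite^{-i\theta}\in\Omega\ \text{for all}\ \theta\in[0,\alpha]\}\}.$$ They are considered on the interval $(t_0(p),+\infty)$, $t_0(p):=\inf\{t\ge0: p+it\in\Omega\}$. *)

theory Defs
  imports "HOL-Complex_Analysis.Complex_Analysis"
begin

abbreviation unit_disk :: "complex set" ("\<bbbD>")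
  where "\<bbbD> \<equiv> ball 0 1"

text \<open>Only the values \<open>\<phi> t z\<close> with \<open>t \<ge> 0\<close> and \<open>z \<in> \<bbbD>\<close> are constrained. The last
  conjunct is continuity of \<open>t \<mapsto> \<phi>\<^sub>t\<close> on \<open>[0, \<infinity>)\<close> for the topology of uniform convergence
  on compacta.\<close>

definition disk_semigroup :: "(real \<Rightarrow> complex \<Rightarrow> complex) \<Rightarrow> bool" where
  "disk_semigroup \<phi> \<longleftrightarrow>
     (\<forall>t\<ge>0. \<phi> t holomorphic_on \<bbbD> \<and> \<phi> t ` \<bbbD> \<subseteq> \<bbbD>) \<and>
     (\<forall>z\<in>\<bbbD>. \<phi> 0 z = z) \<and>
     (\<forall>s\<ge>0. \<forall>t\<ge>0. \<forall>z\<in>\<bbbD>. \<phi> (s + t) z = \<phi> s (\<phi> t z)) \<and>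
     (\<forall>t\<ge>0. \<forall>K. compact K \<and> K \<subseteq> \<bbbD> \<longrightarrow> uniform_limit K \<phi> (\<phi> t) (at t within {0..}))"

definition non_elliptic :: "(real \<Rightarrow> complex \<Rightarrow> complex) \<Rightarrow> bool" where
  "non_elliptic \<phi> \<longleftrightarrow> (\<forall>t>0. \<forall>z\<in>\<bbbD>. \<phi> t z \<noteq> z)"

definition denjoy_wolff_point :: "(real \<Rightarrow> complex \<Rightarrow> complex) \<Rightarrow> complex \<Rightarrow> bool" where
  "denjoy_wolff_point \<phi> \<tau> \<longleftrightarrow>
     \<tau> \<in> sphere 0 1 \<and> (\<forall>z\<in>\<bbbD>. ((\<lambda>t. \<phi> t z) \<longlongrightarrow> \<tau>) at_top)"

definition koenigs_function :: "(real \<Rightarrow> complex \<Rightarrow> complex) \<Rightarrow> (complex \<Rightarrow> complex) \<Rightarrow> bool" where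
  "koenigs_function \<phi> h \<longleftrightarrow>
     h holomorphic_on \<bbbD> \<and> inj_on h \<bbbD> \<and>
     (\<forall>t\<ge>0. \<forall>z\<in>\<bbbD>. h (\<phi> t z) = h z + \<i> * of_real t)"

text \<open>For a curve \<open>\<gamma>\<close> in the disk, \<open>1 - cnj \<tau> * \<gamma> t\<close> has positive real part, so that
  the library's \<open>Arg\<close>, with values in \<open>(-\<pi>, \<pi>]\<close>, takes values in \<open>(-\<pi>/2, \<pi>/2)\<close> here.\<close>

definition slope_set :: "(real \<Rightarrow> complex) \<Rightarrow> complex \<Rightarrow> real set" where
  "slope_set \<gamma> \<tau> =
     {\<theta> \<in> {-pi/2..pi/2}. \<exists>s :: nat \<Rightarrow> real. (\<forall>n. s n \<ge> 0) \<and> filterlim s at_top sequentially \<and>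
        (\<lambda>n. Arg (1 - cnj \<tau> * \<gamma> (s n))) \<longlonglongrightarrow> \<theta>}"

definition converges_nontangentially :: "(real \<Rightarrow> complex) \<Rightarrow> complex \<Rightarrow> bool" where
  "converges_nontangentially \<gamma> \<tau> \<longleftrightarrow>
     (\<gamma> \<longlongrightarrow> \<tau>) at_top \<and> compact (slope_set \<gamma> \<tau>) \<and> slope_set \<gamma> \<tau> \<subseteq> {-pi/2<..<pi/2}"

definition converges_with_definite_slope :: "(real \<Rightarrow> complex) \<Rightarrow> complex \<Rightarrow> bool" where
  "converges_with_definite_slope \<gamma> \<tau> \<longleftrightarrow>
     (\<gamma> \<longlongrightarrow> \<tau>) at_top \<and> (\<exists>\<theta>. slope_set \<gamma> \<tau> = {\<theta>})"

definition natural_points :: "complex set \<Rightarrow> complex set" where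
  "natural_points \<Omega> = {p. \<exists>t0\<ge>0. \<forall>t>t0. p + \<i> * of_real t \<in> \<Omega>}"

text \<open>The supremum is taken in the extended reals: when the whole circle of radius \<open>t\<close>
  about \<open>p\<close> lies in \<open>\<Omega>\<close> it is \<open>\<infinity>\<close>, and the angular extent is \<open>\<pi>\<close>. (The supremum of an
  unbounded set of type \<open>real set\<close> would be unspecified.) The definitions are meaningful
  for \<open>t > 0\<close> with \<open>p + \<i> t \<in> \<Omega>\<close>.\<close>

definition left_angular_extent :: "complex set \<Rightarrow> complex \<Rightarrow> real \<Rightarrow> real" where
  "left_angular_extent \<Omega> p t = real_of_ereal (min (ereal pi)
     (SUP \<alpha>\<in>{\<alpha>. \<alpha> > 0 \<and> (\<forall>\<theta>\<in>{0..\<alpha>}. p + \<i> * of_real t * cis \<theta> \<in> \<Omega>)}. ereal \<alpha>))"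

definition right_angular_extent :: "complex set \<Rightarrow> complex \<Rightarrow> real \<Rightarrow> real" where
  "right_angular_extent \<Omega> p t = real_of_ereal (min (ereal pi)
     (SUP \<alpha>\<in>{\<alpha>. \<alpha> > 0 \<and> (\<forall>\<theta>\<in>{0..\<alpha>}. p + \<i> * of_real t * cis (-\<theta>) \<in> \<Omega>)}. ereal \<alpha>))"

end

theory Submission
  imports Defs
begin

text \<open>
  The slope of a trajectory is read off in the right half-plane. Put
  \<open>\<zeta>(t) = (1 + u) / (1 - u)\<close> with \<open>u = cnj \<tau> * \<phi> t z\<close>; this coordinate sends \<open>\<tau>\<close> to infinity, and
  \<open>1 - u = 2 / (\<zeta> + 1)\<close>, so that it suffices to find the limit of \<open>Im \<zeta> / Re \<zeta>\<close> while \<open>\<zeta>\<close> tends to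
  infinity. If \<open>\<psi>\<close> denotes the conformal map of \<open>\<Omega>\<close> onto the half-plane induced by the inverse of \<open>h\<close>,
  then \<open>\<zeta>(t) = \<psi>(h z + \<i> t)\<close>: the trajectory is the conformal image of a vertical ray.

  Seen from \<open>h z\<close> and divided by \<open>t\<close>, the domain \<open>\<Omega>\<close> converges, as \<open>t\<close> tends to infinity, to the
  sector with vertex \<open>0\<close> and opening angles \<open>\<alpha>l\<close> and \<open>\<alpha>r\<close> on the two sides of the vertical direction.
  Hence, near the point \<open>h z + \<i> t\<close>, the map \<open>\<psi>\<close> looks more and more like a conformal map of the
  sector, up to an automorphism of the half-plane that is unknown and depends on \<open>t\<close>. This is enough to
  know every quantity that does not change under such automorphisms. Two of them are used: in the
  logarithmic time \<open>s = ln t\<close>, the hyperbolic speed of the curve \<open>\<zeta>\<close>, and its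
  geodesic curvature. Both converge to the values that they have on the vertical ray from the vertex of
  the sector (lemma \<open>log_time_invariants\<close>). The power map of exponent \<open>pi / (\<alpha>l + \<alpha>r)\<close>, suitably
  rotated, takes the sector to the half-plane and that ray to the ray from \<open>0\<close> of argument \<open>- \<eta> * (pi / 2)\<close>,
  so that both limits can be computed.

  It remains to recover the Euclidean direction of \<open>\<zeta>\<close> from its asymptotic curvature (lemma
  \<open>halfplane_curve_slope\<close>). With \<open>A = \<zeta>' / Re \<zeta>\<close> the definition of the curvature is a differential
  equation for the direction of \<open>A\<close>, which in the limit has one equilibrium with \<open>Re A > 0\<close>, which is
  unstable, and one with \<open>Re A < 0\<close>. In the second case \<open>Re \<zeta>\<close> would decay
  exponentially and \<open>\<zeta>\<close> would stay bounded, which is impossible because \<open>\<phi> t z\<close> tends to \<open>\<tau>\<close>. A curve that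
  avoids this fate for ever has to converge to the unstable equilibrium, whose direction is the slope
  that is claimed.

  The convergence to the sector is a case of the Caratheodory kernel theorem
  (theorem \<open>subsequence_invariants\<close>). Let \<open>f\<close> be the Riemann maps of the
  rescaled domains. They form a normal family because the domains omit horizontal half-lines. Hurwitz's
  theorem keeps the image of every limit inside the sector, while the inverse maps, which are
  bounded on compact subsets of the sector, converge to a right inverse of the limit;
  the Schwarz lemma, used in both directions, shows that the limit is a Riemann map of the sector. The sector
  is described by the strip of its logarithms, which turns boundary rays into horizontal lines
  and the dilations into translations.
\<close>

section \<open>Moebius coordinates of the right half-plane\<close>

text \<open>The conformal map of the right half-plane onto the unit disk that sends \<open>w\<close> to \<open>0\<close>; its modulus is
  the pseudo-hyperbolic distance to \<open>w\<close>.\<close>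
definition hp_to_disk :: "complex \<Rightarrow> complex \<Rightarrow> complex" where
  "hp_to_disk w z = (z - w) / (z + cnj w)"

text \<open>The inverse of the previous map. For \<open>w = 1\<close> it is the Cayley transform.\<close>
definition disk_to_hp :: "complex \<Rightarrow> complex \<Rightarrow> complex" where
  "disk_to_hp w u = (w + u * cnj w) / (1 - u)"

lemma hp_add_cnj_nonzero:
  assumes "Re w > 0" "Re z > 0" shows "z + cnj w \<noteq> 0"
  using assms by (auto simp: complex_eq_iff)

lemma hp_to_disk_self [simp]: "hp_to_disk w w = 0"
  by (simp add: hp_to_disk_def)

lemma norm_hp_to_disk:
  assumes "Re w > 0" "Re z > 0" shows "norm (hp_to_disk w z) < 1"
proof -
  have "Re w * Re z > 0" using assms by simp
  then have "(norm (z - w))\<^sup>2 < (norm (z + cnj w))\<^sup>2"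
    unfolding cmod_power2 by (simp add: power2_eq_square algebra_simps)
  then have "norm (z - w) < norm (z + cnj w)" by (rule power2_less_imp_less) simp
  then show ?thesis
    using hp_add_cnj_nonzero[OF assms] by (simp add: hp_to_disk_def norm_divide)
qed

lemma Re_disk_to_hp:
  assumes "Re w > 0" "norm u < 1" shows "Re (disk_to_hp w u) > 0"
proof -
  have "1 - u \<noteq> 0" using assms by auto
  have "(norm u)\<^sup>2 < 1" using assms by (simp add: power_less_one_iff)
  then have "(Re u)\<^sup>2 + (Im u)\<^sup>2 < 1" by (simp add: cmod_power2)
  have "Re ((w + u * cnj w) * cnj (1 - u)) = Re w * (1 - ((Re u)\<^sup>2 + (Im u)\<^sup>2))"
    by (simp add: algebra_simps power2_eq_square)
  then have "Re ((w + u * cnj w) * cnj (1 - u)) > 0"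
    using assms \<open>(Re u)\<^sup>2 + (Im u)\<^sup>2 < 1\<close> by simp
  moreover have "disk_to_hp w u = ((w + u * cnj w) * cnj (1 - u)) / of_real ((norm (1 - u))\<^sup>2)"
    unfolding disk_to_hp_def complex_norm_square using \<open>1 - u \<noteq> 0\<close>
    by (simp del: complex_cnj_diff)
  ultimately show ?thesis using \<open>1 - u \<noteq> 0\<close> by (simp only: Re_divide_of_real) simp
qed

lemma disk_to_hp_to_disk:
  assumes "Re w > 0" "Re z > 0" shows "disk_to_hp w (hp_to_disk w z) = z"
proof -
  have nz: "z + cnj w \<noteq> 0" "w + cnj w \<noteq> 0" using hp_add_cnj_nonzero assms by auto
  have "1 - hp_to_disk w z = (w + cnj w) / (z + cnj w)"
    "w + hp_to_disk w z * cnj w = z * ((w + cnj w) / (z + cnj w))"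
    using nz by (simp_all add: hp_to_disk_def field_simps)
  then show ?thesis using nz by (simp add: disk_to_hp_def)
qed

lemma hp_to_disk_to_hp:
  assumes "Re w > 0" "norm u < 1" shows "hp_to_disk w (disk_to_hp w u) = u"
proof -
  have nz: "1 - u \<noteq> 0" "w + cnj w \<noteq> 0" using hp_add_cnj_nonzero assms by auto
  have "disk_to_hp w u - w = u * ((w + cnj w) / (1 - u))" "disk_to_hp w u + cnj w = (w + cnj w) / (1 - u)"
    using nz by (simp_all add: disk_to_hp_def field_simps)
  then show ?thesis using nz by (simp add: hp_to_disk_def)
qed

lemma holomorphic_on_hp_to_disk:
  assumes "f holomorphic_on S" "Re w > 0" "\<And>z. z \<in> S \<Longrightarrow> Re (f z) > 0"
  shows "(\<lambda>z. hp_to_disk w (f z)) holomorphic_on S"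
  unfolding hp_to_disk_def using assms hp_add_cnj_nonzero
  by (intro holomorphic_intros) auto

lemma holomorphic_on_disk_to_hp:
  assumes "f holomorphic_on S" "\<And>z. z \<in> S \<Longrightarrow> norm (f z) < 1"
  shows "(\<lambda>z. disk_to_hp w (f z)) holomorphic_on S"
proof -
  have "1 - f z \<noteq> 0" if "z \<in> S" for z using assms(2)[OF that] by auto
  then show ?thesis unfolding disk_to_hp_def using assms(1) by (intro holomorphic_intros) auto
qed

text \<open>Passing to the disk coordinate centred at \<open>\<Psi> W0\<close> turns the derivatives of \<open>\<Psi>\<close> at \<open>W0\<close> into invariants:
  \<open>norm (deriv X W0)\<close> is half the hyperbolic density, and the quotient \<open>deriv (deriv X) W0 / deriv X W0\<close> equals
  \<open>\<Psi>'' / \<Psi>' - \<Psi>' / Re \<Psi>\<close>, which does not change when \<open>\<Psi>\<close> is composed with an automorphism of the half-plane.\<close>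
lemma deriv_hp_to_disk:
  assumes hol: "\<Psi> holomorphic_on S" and "open S" "W0 \<in> S"
    and pos: "\<And>W. W \<in> S \<Longrightarrow> Re (\<Psi> W) > 0"
  defines "X \<equiv> \<lambda>W. hp_to_disk (\<Psi> W0) (\<Psi> W)" and "x \<equiv> complex_of_real (Re (\<Psi> W0))"
  shows "deriv X W0 = deriv \<Psi> W0 / (2 * x)"
    and "deriv (deriv X) W0 = deriv (deriv \<Psi>) W0 / (2 * x) - (deriv \<Psi> W0)\<^sup>2 / (2 * x\<^sup>2)"
proof -
  have xx: "\<Psi> W0 + cnj (\<Psi> W0) = 2 * x" by (simp add: x_def complex_add_cnj)
  have x0: "x \<noteq> 0" using pos[OF \<open>W0 \<in> S\<close>] by (simp add: x_def)
  have nz: "\<Psi> W + cnj (\<Psi> W0) \<noteq> 0" if "W \<in> S" for W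
    using hp_add_cnj_nonzero pos that \<open>W0 \<in> S\<close> by blast
  have d1: "(\<Psi> has_field_derivative deriv \<Psi> W) (at W)" if "W \<in> S" for W
    using holomorphic_derivI[OF hol \<open>open S\<close> that] .
  have d2: "(deriv \<Psi> has_field_derivative deriv (deriv \<Psi>) W) (at W)" if "W \<in> S" for W
    using holomorphic_derivI[OF holomorphic_deriv[OF hol \<open>open S\<close>] \<open>open S\<close> that] .
  have dX: "deriv X W = deriv \<Psi> W * (\<Psi> W0 + cnj (\<Psi> W0)) / (\<Psi> W + cnj (\<Psi> W0))\<^sup>2" if "W \<in> S" for W
    unfolding X_def hp_to_disk_def
    by (rule DERIV_imp_deriv)
       (use nz[OF that] in \<open>auto intro!: derivative_eq_intros d1[OF that] simp: power2_eq_square field_simps\<close>)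
  show "deriv X W0 = deriv \<Psi> W0 / (2 * x)"
    using dX[OF \<open>W0 \<in> S\<close>] x0 by (simp add: xx power2_eq_square)
  have "deriv (deriv X) W0 = deriv (\<lambda>W. deriv \<Psi> W * (\<Psi> W0 + cnj (\<Psi> W0)) / (\<Psi> W + cnj (\<Psi> W0))\<^sup>2) W0"
    using dX \<open>open S\<close> \<open>W0 \<in> S\<close> by (intro deriv_cong_ev refl) (auto simp: eventually_nhds)
  also have "\<dots> = deriv (deriv \<Psi>) W0 / (2 * x) - (deriv \<Psi> W0)\<^sup>2 / (2 * x\<^sup>2)"
    apply (rule DERIV_imp_deriv)
    apply (rule derivative_eq_intros d1[OF \<open>W0 \<in> S\<close>] d2[OF \<open>W0 \<in> S\<close>] refl)+
    unfolding xx using x0 by (simp_all add: power2_eq_square field_simps)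
  finally show "deriv (deriv X) W0 = deriv (deriv \<Psi>) W0 / (2 * x) - (deriv \<Psi> W0)\<^sup>2 / (2 * x\<^sup>2)" .
qed

text \<open>The Schwarz lemma for maps into the half-plane, solved for the modulus.\<close>
lemma halfplane_valued_growth:
  assumes hol: "G holomorphic_on ball 0 1" and pos: "\<And>u. norm u < 1 \<Longrightarrow> Re (G u) > 0" and u: "norm u < 1"
  shows "norm (G u) \<le> norm (G 0) * ((1 + norm u) / (1 - norm u))"
proof -
  have "norm (hp_to_disk (G 0) (G u)) \<le> norm u"
    using u pos by (intro Schwarz_Lemma(1)[of "\<lambda>u. hp_to_disk (G 0) (G u)"])
      (auto intro!: holomorphic_on_hp_to_disk hol norm_hp_to_disk)
  then have "norm (G u - G 0) \<le> norm u * norm (G u + cnj (G 0))"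
    using hp_add_cnj_nonzero[of "G 0" "G u"] pos[of 0] pos[OF u]
    by (simp add: hp_to_disk_def norm_divide field_simps)
  also have "\<dots> \<le> norm u * (norm (G u) + norm (G 0))"
    by (intro mult_left_mono order_trans[OF norm_triangle_ineq]) auto
  finally have "norm (G u) - norm (G 0) \<le> norm u * (norm (G u) + norm (G 0))"
    using norm_triangle_ineq2[of "G u" "G 0"] by linarith
  then show ?thesis using u by (simp add: field_simps)
qed

text \<open>The square root maps the complement of the half-line \<open>q - [0, \<infinity>)\<close> into the half-plane, and
  squaring the previous estimate gives a bound that depends only on the distance from \<open>q\<close> to the value at the
  origin. It yields normality of families of maps into domains that omit such half-lines.\<close>
lemma halfline_omitting_growth:
  assumes hol: "f holomorphic_on ball 0 1"
    and omit: "\<And>u r. norm u < 1 \<Longrightarrow> r \<ge> 0 \<Longrightarrow> f u \<noteq> q - complex_of_real r" and u: "norm u < 1"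
  shows "norm (f u - q) \<le> norm (f 0 - q) * ((1 + norm u) / (1 - norm u))\<^sup>2"
proof -
  have slit: "f u - q \<notin> \<real>\<^sub>\<le>\<^sub>0" if "norm u < 1" for u
  proof
    assume "f u - q \<in> \<real>\<^sub>\<le>\<^sub>0"
    then obtain r where "f u - q = of_real r" "r \<le> 0" by (auto elim: nonpos_Reals_cases)
    then have "f u = q - of_real (- r)" by (simp add: algebra_simps)
    with omit[OF that, of "- r"] \<open>r \<le> 0\<close> show False by simp
  qed
  define G where "G = (\<lambda>u. csqrt (f u - q))"
  have "Re (G u) > 0" if "norm u < 1" for u
  proof -
    have "Re (G u) \<noteq> 0"
    proof
      assume "Re (G u) = 0"
      then have "G u = \<i> * of_real (Im (G u))" by (simp add: complex_eq_iff)
      then have "(G u)\<^sup>2 = - of_real ((Im (G u))\<^sup>2)" by (metis i_squared mult_minus1 of_real_power power_mult_distrib power2_i)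
      then have "f u - q = of_real (- ((Im (G u))\<^sup>2))" by (simp add: G_def)
      with slit[OF that] show False by (simp add: complex_nonpos_Reals_iff)
    qed
    moreover have "Re (G u) \<ge> 0" unfolding G_def by (rule Re_csqrt)
    ultimately show ?thesis by simp
  qed
  moreover have "G holomorphic_on ball 0 1"
    unfolding G_def using slit hol by (intro holomorphic_intros) auto
  ultimately have "norm (G u) \<le> norm (G 0) * ((1 + norm u) / (1 - norm u))"
    using u by (intro halfplane_valued_growth)
  then have "(norm (G u))\<^sup>2 \<le> (norm (G 0) * ((1 + norm u) / (1 - norm u)))\<^sup>2"
    by (intro power_mono) auto
  moreover have "(norm (G v))\<^sup>2 = norm (f v - q)" for v
    by (simp add: G_def flip: norm_power)
  ultimately show ?thesis unfolding power_mult_distrib by simp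
qed

section \<open>Riemann maps of domains converging to a sector\<close>

lemma uniform_limit_diagonal:
  fixes f :: "nat \<Rightarrow> complex \<Rightarrow> complex"
  assumes lim: "\<And>K. compact K \<Longrightarrow> K \<subseteq> ball 0 1 \<Longrightarrow> uniform_limit K f F sequentially"
    and "F holomorphic_on ball 0 1" "z \<longlonglongrightarrow> l" "norm l < 1"
  shows "(\<lambda>n. f n (z n)) \<longlonglongrightarrow> F l"
proof -
  obtain \<rho> where \<rho>: "norm l < \<rho>" "\<rho> < 1" using dense \<open>norm l < 1\<close> by blast
  have ev: "\<forall>\<^sub>F n in sequentially. z n \<in> cball 0 \<rho>"
    using order_tendstoD(2)[OF tendsto_norm[OF \<open>z \<longlonglongrightarrow> l\<close>] \<rho>(1)] by eventually_elim auto
  have "uniform_limit (cball 0 \<rho>) f F sequentially" using \<rho> by (intro lim) auto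
  moreover have "continuous_on (cball 0 \<rho>) F"
    using \<open>F holomorphic_on ball 0 1\<close> \<rho> by (intro holomorphic_on_imp_continuous_on) (auto elim: holomorphic_on_subset)
  ultimately have "\<forall>\<^sub>F n in sequentially. dist (f n (z n)) (F (z n)) < e" if "e > 0" for e
    using ev uniform_limitD[OF _ that] by (fastforce elim: eventually_elim2)
  then have 1: "(\<lambda>n. f n (z n) - F (z n)) \<longlonglongrightarrow> 0"
    by (intro tendstoI) (simp add: dist_norm)
  have "isCont F l"
    using holomorphic_on_imp_continuous_on[OF \<open>F holomorphic_on ball 0 1\<close>] \<open>norm l < 1\<close>
    by (simp add: continuous_on_eq_continuous_at)
  then have 2: "(\<lambda>n. F (z n)) \<longlonglongrightarrow> F l" using \<open>z \<longlonglongrightarrow> l\<close> by (rule isCont_tendsto_compose)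
  show ?thesis using tendsto_add[OF 1 2] by simp
qed

text \<open>Hurwitz's theorem for omitted values that move with the sequence.\<close>
lemma Hurwitz_limit_omits:
  fixes f :: "nat \<Rightarrow> complex \<Rightarrow> complex"
  assumes lim: "\<And>K. compact K \<Longrightarrow> K \<subseteq> ball 0 1 \<Longrightarrow> uniform_limit K f F sequentially"
    and hol: "\<And>n. f n holomorphic_on ball 0 1" and F: "F holomorphic_on ball 0 1" "\<not> F constant_on ball 0 1"
    and "\<beta> \<longlonglongrightarrow> l" and omit: "\<forall>\<^sub>F n in sequentially. \<forall>u\<in>ball 0 1. f n u \<noteq> \<beta> n"
    and "u \<in> ball 0 1"
  shows "F u \<noteq> l"
proof -
  obtain N where N: "\<And>n u. n \<ge> N \<Longrightarrow> u \<in> ball 0 1 \<Longrightarrow> f n u \<noteq> \<beta> n"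
    using omit unfolding eventually_sequentially by (metis (no_types))
  have "F u - l \<noteq> 0"
  proof (rule Hurwitz_no_zeros[where S = "ball 0 1" and \<F> = "\<lambda>n u. f (n + N) u - \<beta> (n + N)" and g = "\<lambda>u. F u - l"])
    show "uniform_limit K (\<lambda>n u. f (n + N) u - \<beta> (n + N)) (\<lambda>u. F u - l) sequentially"
      if "compact K" "K \<subseteq> ball 0 1" for K
    proof (rule uniform_limit_minus)
      show "uniform_limit K (\<lambda>n. f (n + N)) F sequentially"
        using filterlim_compose[OF lim[OF that] filterlim_add_const_nat_at_top[of N]] by simp
      show "uniform_limit K (\<lambda>n _. \<beta> (n + N)) (\<lambda>_. l) sequentially"
      proof (rule uniform_limitI)
        fix e :: real assume "e > 0"
        with LIMSEQ_ignore_initial_segment[OF \<open>\<beta> \<longlonglongrightarrow> l\<close>, of N]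
        show "\<forall>\<^sub>F n in sequentially. \<forall>x\<in>K. dist (\<beta> (n + N)) l < e"
          by (auto dest: tendstoD elim: eventually_mono)
      qed
    qed
    show "\<not> (\<lambda>u. F u - l) constant_on ball 0 1"
      using F(2) by (auto simp: constant_on_def algebra_simps)
  qed (use hol F N \<open>u \<in> ball 0 1\<close> in \<open>auto intro!: holomorphic_intros\<close>)
  then show ?thesis by simp
qed

definition strip :: "real \<Rightarrow> real \<Rightarrow> complex set" where
  "strip a b = {W. - b < Im W \<and> Im W < a}"

lemma open_strip: "open (strip a b)"
  unfolding strip_def by (intro open_Collect_conj open_Collect_less continuous_intros)

text \<open>
  A sequence of domains \<open>V n\<close>, starlike in the positive direction, with Riemann maps \<open>X n\<close>, inverse maps \<open>f n\<close>
  and base point \<open>1\<close>, which converges to the sector \<open>exp ` strip a b\<close> as seen from \<open>1\<close>: compact subsets of the sector are eventually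
  contained in \<open>V n\<close>, and all boundary points of the sector, including the vertex, are limits of points outside \<open>V n\<close>.
  The maps \<open>T\<close> and \<open>E\<close> are a Riemann map of the strip and its inverse. For
  \<open>a, b \<le> pi\<close> the exponential function is injective on the open strip, so the sector has a single-valued logarithm.\<close>
locale dilated_domains =
  fixes a b :: real and T E :: "complex \<Rightarrow> complex" and V :: "nat \<Rightarrow> complex set"
    and X f :: "nat \<Rightarrow> complex \<Rightarrow> complex" and q :: "nat \<Rightarrow> complex"
  assumes ab: "0 < a" "a \<le> pi" "0 < b" "b \<le> pi"
    and T_hol: "T holomorphic_on strip a b" and T_disk: "\<And>W. W \<in> strip a b \<Longrightarrow> norm (T W) < 1"
    and E_hol: "E holomorphic_on ball 0 1" and E_strip: "\<And>u. norm u < 1 \<Longrightarrow> E u \<in> strip a b"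
    and TE: "\<And>u. norm u < 1 \<Longrightarrow> T (E u) = u" and ET: "\<And>W. W \<in> strip a b \<Longrightarrow> E (T W) = W"
    and T0: "T 0 = 0"
    and X_hol: "\<And>n. X n holomorphic_on V n" and X_disk: "\<And>n v. v \<in> V n \<Longrightarrow> norm (X n v) < 1"
    and f_hol: "\<And>n. f n holomorphic_on ball 0 1" and f_V: "\<And>n u. norm u < 1 \<Longrightarrow> f n u \<in> V n"
    and fX: "\<And>n v. v \<in> V n \<Longrightarrow> f n (X n v) = v"
    and base: "\<And>n. 1 \<in> V n" "\<And>n. X n 1 = 0"
    and exhaust: "\<And>K. compact K \<Longrightarrow> K \<subseteq> strip a b \<Longrightarrow> \<forall>\<^sub>F n in sequentially. exp ` K \<subseteq> V n"
    and starlike: "\<And>n v r. v \<in> V n \<Longrightarrow> r \<ge> 0 \<Longrightarrow> v + complex_of_real r \<in> V n"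
    and q_out: "\<And>n. q n \<notin> V n" and q_lim: "q \<longlonglongrightarrow> 0"
    and left_out: "\<And>x. \<exists>\<beta>. (\<forall>\<^sub>F n in sequentially. \<beta> n \<notin> V n) \<and> \<beta> \<longlonglongrightarrow> exp (Complex x a)"
    and right_out: "\<And>x. \<exists>\<beta>. (\<forall>\<^sub>F n in sequentially. \<beta> n \<notin> V n) \<and> \<beta> \<longlonglongrightarrow> exp (Complex x (- b))"
begin

lemma zero_in_strip: "0 \<in> strip a b"
  using ab by (simp add: strip_def)

lemma E0: "E 0 = 0"
  using ET[OF zero_in_strip] T0 by simp

lemma f0: "f n 0 = 1"
  using fX[OF base(1)] base(2) by metis

lemma inverse_maps_subsequence:
  obtains F r where "F holomorphic_on ball 0 1" "strict_mono (r :: nat \<Rightarrow> nat)"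
    "\<And>K. compact K \<Longrightarrow> K \<subseteq> ball 0 1 \<Longrightarrow> uniform_limit K (f \<circ> r) F sequentially"
proof -
  \<comment> \<open>The omitted half-lines start at the points \<open>q n\<close>, which stay bounded.\<close>
  obtain Q where "Q > 0" and Q: "\<And>n. norm (q n) \<le> Q"
    using q_lim by (meson Bseq_def convergentI convergent_imp_Bseq)
  have bounded: "\<exists>B. \<forall>g\<in>range f. \<forall>z\<in>K. norm (g z) \<le> B" if K: "compact K" "K \<subseteq> ball 0 1" for K
  proof (cases "K = {}")
    case False
    obtain z0 where z0: "z0 \<in> K" "\<And>z. z \<in> K \<Longrightarrow> norm z \<le> norm z0"
      using continuous_attains_sup[OF K(1) False, of norm] by (auto intro: continuous_intros)
    define \<rho> where "\<rho> = norm z0"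
    have \<rho>: "\<rho> < 1" "\<rho> \<ge> 0" using z0 K by (auto simp: \<rho>_def)
    have "norm (f n z) \<le> Q + (1 + Q) * ((1 + \<rho>) / (1 - \<rho>))\<^sup>2" if "z \<in> K" for n z
    proof -
      have "norm z \<le> \<rho>" using z0(2)[OF that] by (simp add: \<rho>_def)
      then have z: "norm z \<le> \<rho>" "norm z < 1" using \<rho> by auto
      have "norm (f n z - q n) \<le> norm (f n 0 - q n) * ((1 + norm z) / (1 - norm z))\<^sup>2"
      proof (rule halfline_omitting_growth[OF f_hol _ z(2)])
        fix u :: complex and r :: real assume "norm u < 1" "r \<ge> 0"
        then show "f n u \<noteq> q n - of_real r"
          using starlike[OF f_V[of u n], of r] q_out[of n] by auto
      qed
      also have "\<dots> \<le> (1 + Q) * ((1 + \<rho>) / (1 - \<rho>))\<^sup>2"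
      proof (intro mult_mono power_mono frac_le)
        have "norm (f n 0 - q n) \<le> norm (f n 0) + norm (q n)" by (rule norm_triangle_ineq4)
        then show "norm (f n 0 - q n) \<le> 1 + Q" using Q[of n] by (simp add: f0)
      qed (use z \<rho> \<open>Q > 0\<close> in auto)
      finally show ?thesis
        using Q[of n] norm_triangle_ineq2[of "f n z" "q n"] by linarith
    qed
    then show ?thesis by blast
  qed auto
  show thesis
    by (rule Montel[of "ball 0 1" "range f" f]) (use f_hol bounded that in auto)
qed

text \<open>The inverse maps \<open>X n\<close> are defined only on \<open>V n\<close>, but on a compact part \<open>E ` cball 0 \<rho>\<close> of the strip they are
  eventually available and bounded by \<open>1\<close>. In the limit they give a right inverse of the limit \<open>F\<close> of the maps
  \<open>f n\<close>. The factor \<open>\<rho>\<close> rescales the domain to the unit disk so that the Schwarz lemma applies.\<close>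
lemma scaled_maps_subsequence:
  assumes F: "F holomorphic_on ball 0 1" and r: "strict_mono (r :: nat \<Rightarrow> nat)"
    and lim: "\<And>K. compact K \<Longrightarrow> K \<subseteq> ball 0 1 \<Longrightarrow> uniform_limit K (f \<circ> r) F sequentially"
    and \<rho>: "0 < \<rho>" "\<rho> < 1"
  obtains \<kappa> s where "strict_mono (s :: nat \<Rightarrow> nat)" "\<kappa> holomorphic_on ball 0 1"
    "\<And>n. (\<lambda>u. X (s n) (exp (E (of_real \<rho> * u)))) holomorphic_on ball 0 1"
    "\<And>K. compact K \<Longrightarrow> K \<subseteq> ball 0 1 \<Longrightarrow>
       uniform_limit K (\<lambda>n u. X (s n) (exp (E (of_real \<rho> * u)))) \<kappa> sequentially"
    "\<And>u. norm u < 1 \<Longrightarrow> norm (\<kappa> u) \<le> norm u"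
    "\<And>u. norm u < 1 \<Longrightarrow> F (\<kappa> u) = exp (E (of_real \<rho> * u))"
proof -
  define K0 where "K0 = E ` cball 0 \<rho>"
  have "continuous_on (cball 0 \<rho>) E"
    using \<rho> by (intro holomorphic_on_imp_continuous_on holomorphic_on_subset[OF E_hol]) auto
  then have "compact K0" by (simp add: K0_def compact_continuous_image)
  moreover have "K0 \<subseteq> strip a b" using \<rho> E_strip by (auto simp: K0_def)
  ultimately obtain N where N: "\<And>n. n \<ge> N \<Longrightarrow> exp ` K0 \<subseteq> V n"
    using exhaust[of K0] unfolding eventually_sequentially by meson
  have small: "norm (of_real \<rho> * u) < 1 \<and> of_real \<rho> * u \<in> cball 0 \<rho>" if "norm u < 1" for u :: complex
  proof -
    have "norm (of_real \<rho> * u) \<le> \<rho>" using that \<rho> by (simp add: norm_mult mult_left_le)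
    then show ?thesis using \<rho> by auto
  qed
  define k where "k = (\<lambda>n u. X n (exp (E (of_real \<rho> * u))))"
  have in_V: "exp (E (of_real \<rho> * u)) \<in> V n" if "norm u < 1" "n \<ge> N" for u n
    using N[OF that(2)] small[OF that(1)] by (auto simp: K0_def)
  have k_hol: "k n holomorphic_on ball 0 1" if "n \<ge> N" for n
  proof -
    have "(\<lambda>u. E (of_real \<rho> * u)) holomorphic_on ball 0 1"
      using small by (intro holomorphic_on_compose_gen[OF _ E_hol, unfolded o_def]) (auto intro!: holomorphic_intros)
    then have "(\<lambda>u. exp (E (of_real \<rho> * u))) holomorphic_on ball 0 1"
      by (intro holomorphic_intros)
    then show ?thesis unfolding k_def
      using in_V[OF _ that] by (intro holomorphic_on_compose_gen[OF _ X_hol, unfolded o_def]) auto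
  qed
  have k_disk: "norm (k n u) < 1" if "norm u < 1" "n \<ge> N" for n u
    using X_disk in_V[OF that] by (simp add: k_def)
  have k_le: "norm (k n u) \<le> norm u" if "norm u < 1" "n \<ge> N" for n u
    using Schwarz_Lemma(1)[OF k_hol] k_disk that by (simp add: k_def E0 base)
  obtain \<kappa> s where \<kappa>: "\<kappa> holomorphic_on ball 0 1" "strict_mono (s :: nat \<Rightarrow> nat)"
      "\<And>u. u \<in> ball 0 1 \<Longrightarrow> (\<lambda>n. k (r (s n + N)) u) \<longlonglongrightarrow> \<kappa> u"
      "\<And>K. compact K \<Longrightarrow> K \<subseteq> ball 0 1 \<Longrightarrow> uniform_limit K ((\<lambda>n. k (r (n + N))) \<circ> s) \<kappa> sequentially"
  proof (rule Montel[of "ball 0 1" "range (\<lambda>n. k (r (n + N)))" "\<lambda>n. k (r (n + N))"])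
    have le: "r (n + N) \<ge> N" for n
      using seq_suble[OF r, of "n + N"] by simp
    show "g holomorphic_on ball 0 1" if "g \<in> range (\<lambda>n. k (r (n + N)))" for g
      using that k_hol le by auto
    show "\<exists>B. \<forall>g\<in>range (\<lambda>n. k (r (n + N))). \<forall>z\<in>K. norm (g z) \<le> B" if "compact K" "K \<subseteq> ball 0 1" for K
      using k_disk le that by (intro exI[of _ 1]) (auto intro!: less_imp_le simp: subset_iff)
  qed (use that in auto)
  define s' where "s' = (\<lambda>n. r (s n + N))"
  have s'N: "s' n \<ge> N" for n using seq_suble[OF r, of "s n + N"] by (simp add: s'_def)
  have s'_mono: "strict_mono s'"
    using r \<kappa>(2) by (auto simp: s'_def strict_mono_def)
  have \<kappa>_le: "norm (\<kappa> u) \<le> norm u" if "norm u < 1" for u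
  proof (rule tendsto_upperbound)
    show "(\<lambda>n. norm (k (s' n) u)) \<longlonglongrightarrow> norm (\<kappa> u)"
      using \<kappa>(3)[of u] that by (auto simp: s'_def intro: tendsto_norm)
  qed (use k_le that s'N in auto)
  have "F (\<kappa> u) = exp (E (of_real \<rho> * u))" if u: "norm u < 1" for u
  proof -
    have "(\<lambda>n. f (s' n) (k (s' n) u)) \<longlonglongrightarrow> F (\<kappa> u)"
    proof (rule uniform_limit_diagonal[OF _ F, where f = "\<lambda>n. f (s' n)" and z = "\<lambda>n. k (s' n) u"])
      have "filterlim (\<lambda>n. s n + N) sequentially sequentially"
        using \<kappa>(2) by (intro filterlim_subseq) (auto simp: strict_mono_def)
      then show "uniform_limit K (\<lambda>n. f (s' n)) F sequentially" if "compact K" "K \<subseteq> ball 0 1" for K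
        using filterlim_compose[OF lim[OF that]] by (simp add: s'_def o_def)
      show "(\<lambda>n. k (s' n) u) \<longlonglongrightarrow> \<kappa> u" using \<kappa>(3)[of u] u by (simp add: s'_def)
      show "norm (\<kappa> u) < 1" using \<kappa>_le[OF u] u by simp
    qed
    moreover have "f (s' n) (k (s' n) u) = exp (E (of_real \<rho> * u))" for n
      using fX in_V[OF u s'N] by (simp add: k_def)
    ultimately show ?thesis by (simp add: LIMSEQ_const_iff)
  qed
  then show thesis
    using that[OF s'_mono \<kappa>(1)] k_hol[OF s'N] \<kappa>(4) \<kappa>_le
    by (simp add: k_def s'_def o_def)
qed

text \<open>The limit has a right inverse defined on a part of the sector, so it takes more than one value.\<close>
lemma inverse_limit_nonconstant:
  assumes F: "F holomorphic_on ball 0 1" and r: "strict_mono (r :: nat \<Rightarrow> nat)"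
    and lim: "\<And>K. compact K \<Longrightarrow> K \<subseteq> ball 0 1 \<Longrightarrow> uniform_limit K (f \<circ> r) F sequentially"
  shows "\<not> F constant_on ball 0 1"
proof
  assume "F constant_on ball 0 1"
  then obtain c where c: "\<And>u. norm u < 1 \<Longrightarrow> F u = c" by (auto simp: constant_on_def)
  obtain \<kappa> where \<kappa>: "\<And>u. norm u < 1 \<Longrightarrow> norm (\<kappa> u) \<le> norm u"
      "\<And>u. norm u < 1 \<Longrightarrow> F (\<kappa> u) = exp (E (of_real (1/2) * u))"
    by (rule scaled_maps_subsequence[OF F r lim, of "1/2"]) auto
  have const: "exp (E u) = 1" if "norm u < 1/2" for u
  proof -
    have "norm (2 * u) < 1" using that by (simp add: norm_mult)
    then have "exp (E u) = c" using \<kappa>[of "2 * u"] c[of "\<kappa> (2 * u)"] by simp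
    moreover have "exp (E 0) = c" using \<kappa>[of 0] c[of "\<kappa> 0"] by simp
    ultimately show ?thesis by (simp add: E0)
  qed
  have "isCont T 0"
    using holomorphic_on_imp_continuous_on[OF T_hol] open_strip zero_in_strip
    by (simp add: continuous_on_eq_continuous_at)
  then have "T \<midarrow>0\<rightarrow> 0" using T0 by (simp add: isCont_def)
  then have "\<forall>\<^sub>F W in at 0. norm (T W) < 1/2"
    by (auto dest: tendstoD[of _ _ _ "1/2"])
  then obtain e where e: "e > 0" "\<And>W. W \<noteq> 0 \<Longrightarrow> norm W < e \<Longrightarrow> norm (T W) < 1/2"
    by (auto simp: eventually_at)
  \<comment> \<open>On a small disk \<open>exp \<circ> E\<close> would be constant, but it takes the values \<open>1\<close> and \<open>exp W\<close>.\<close>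
  define W where "W = complex_of_real (e/2)"
  have W: "W \<in> strip a b" "norm (T W) < 1/2" using e ab by (auto simp: W_def strip_def)
  then have "exp W = 1" using const[OF W(2)] ET[OF W(1)] by simp
  then have "exp (e/2) = 1" by (metis W_def exp_of_real of_real_eq_1_iff)
  with \<open>e > 0\<close> show False by simp
qed

text \<open>By Hurwitz's theorem the limit omits the vertex and the boundary rays of the sector. The first fact yields a
  logarithm \<open>L\<close>, the second one says that \<open>Im \<circ> L\<close> omits \<open>a\<close> and \<open>- b\<close>; since \<open>L 0 = 0\<close> and the disk is
  connected, \<open>L\<close> stays in the strip.\<close>
lemma logarithm_of_inverse_limit:
  assumes F: "F holomorphic_on ball 0 1" and r: "strict_mono (r :: nat \<Rightarrow> nat)"
    and lim: "\<And>K. compact K \<Longrightarrow> K \<subseteq> ball 0 1 \<Longrightarrow> uniform_limit K (f \<circ> r) F sequentially"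
  obtains L where "L holomorphic_on ball 0 1" "L 0 = 0"
    "\<And>u. norm u < 1 \<Longrightarrow> L u \<in> strip a b" "\<And>u. norm u < 1 \<Longrightarrow> F u = exp (L u)"
proof -
  have omit: "F u \<noteq> l" if "norm u < 1" "\<forall>\<^sub>F n in sequentially. \<beta> n \<notin> V n" "\<beta> \<longlonglongrightarrow> l" for u \<beta> l
  proof (rule Hurwitz_limit_omits[OF lim _ F inverse_limit_nonconstant[OF F r lim]])
    show "(\<lambda>n. \<beta> (r n)) \<longlonglongrightarrow> l" using LIMSEQ_subseq_LIMSEQ[OF that(3) r] by (simp add: o_def)
    show "\<forall>\<^sub>F n in sequentially. \<forall>u\<in>ball 0 1. (f \<circ> r) n u \<noteq> \<beta> (r n)"
      using eventually_subseq[OF r that(2)]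
    proof eventually_elim
      case (elim n)
      then show ?case using f_V[of _ "r n"] by (metis comp_apply dist_0_norm mem_ball)
    qed
  qed (use f_hol that in \<open>auto simp: o_def\<close>)
  have "F u \<noteq> 0" if "norm u < 1" for u
    using omit[OF that _ q_lim] q_out by simp
  then obtain L0 where L0: "L0 holomorphic_on ball 0 1" "\<And>u. u \<in> ball 0 1 \<Longrightarrow> F u = exp (L0 u)"
    using contractible_imp_holomorphic_log[OF F convex_imp_contractible] by (metis convex_ball dist_0_norm mem_ball)
  have "(\<lambda>n. f (r n) 0) \<longlonglongrightarrow> F 0"
    using uniform_limit_diagonal[OF lim F, of "\<lambda>_. 0" 0] by simp
  then have "F 0 = 1" by (simp add: f0 LIMSEQ_const_iff)
  define L where "L = (\<lambda>u. L0 u - L0 0)"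
  have L: "F u = exp (L u)" if "norm u < 1" for u
    using L0(2)[of u] L0(2)[of 0] that \<open>F 0 = 1\<close> by (simp add: L_def exp_diff)
  have L_hol: "L holomorphic_on ball 0 1" unfolding L_def by (intro holomorphic_intros L0)
  have no_hit: "Im (L u) \<noteq> a \<and> Im (L u) \<noteq> - b" if u: "norm u < 1" for u
  proof -
    have eq: "F u = exp (Complex (Re (L u)) (Im (L u)))" using L[OF u] by simp
    obtain \<beta> where "\<forall>\<^sub>F n in sequentially. \<beta> n \<notin> V n" "\<beta> \<longlonglongrightarrow> exp (Complex (Re (L u)) a)" using left_out by blast
    then have 1: "F u \<noteq> exp (Complex (Re (L u)) a)" by (rule omit[OF u])
    obtain \<beta> where "\<forall>\<^sub>F n in sequentially. \<beta> n \<notin> V n" "\<beta> \<longlonglongrightarrow> exp (Complex (Re (L u)) (- b))" using right_out by blast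
    then have 2: "F u \<noteq> exp (Complex (Re (L u)) (- b))" by (rule omit[OF u])
    show ?thesis using 1 2 eq by metis
  qed
  have "connected ((Im \<circ> L) ` ball 0 1)"
    using holomorphic_on_imp_continuous_on[OF L_hol]
    by (intro connected_continuous_image) (auto intro!: continuous_intros simp: o_def)
  moreover have "0 \<in> (Im \<circ> L) ` ball 0 1" by (auto simp: L_def image_iff intro!: bexI[of _ 0])
  ultimately have "Im (L u) < a \<and> - b < Im (L u)" if u: "norm u < 1" for u
  proof -
    have "Im (L u) \<in> (Im \<circ> L) ` ball 0 1" using u by auto
    then have "a \<in> (Im \<circ> L) ` ball 0 1" if "Im (L u) \<ge> a"
      using connectedD_interval[OF \<open>connected _\<close> \<open>0 \<in> _\<close>, of "Im (L u)" a] that ab by simp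
    moreover have "- b \<in> (Im \<circ> L) ` ball 0 1" if "Im (L u) \<le> - b"
      using connectedD_interval[OF \<open>connected _\<close> \<open>Im (L u) \<in> _\<close> \<open>0 \<in> _\<close>, of "- b"] that ab by simp
    ultimately show ?thesis using no_hit by (force simp: not_less)
  qed
  then show thesis by (intro that[OF L_hol]) (auto simp: strip_def L L_def)
qed

lemma log_unique:
  assumes "W1 \<in> strip a b" "W2 \<in> strip a b" "exp W1 = exp W2"
  shows "W1 = W2"
proof (rule exp_complex_eqI)
  show "\<bar>Im W1 - Im W2\<bar> < 2 * pi" using assms(1,2) ab unfolding strip_def by (auto simp: abs_less_iff)
qed (rule assms)

text \<open>The map \<open>T \<circ> L\<close> of the disk into itself fixes \<open>0\<close>, and \<open>(T \<circ> L) (\<kappa> u) = \<rho> * u\<close> for the map \<open>\<kappa>\<close> belonging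
  to \<open>\<rho>\<close>. Both have derivatives of modulus at most \<open>1\<close> at \<open>0\<close> with product \<open>\<rho>\<close>, so the derivative of \<open>T \<circ> L\<close>
  has modulus at least \<open>\<rho>\<close>, for every \<open>\<rho> < 1\<close>. The equality case of the Schwarz lemma then applies.\<close>
lemma inverse_limit_is_rotation:
  assumes F: "F holomorphic_on ball 0 1" and r: "strict_mono (r :: nat \<Rightarrow> nat)"
    and lim: "\<And>K. compact K \<Longrightarrow> K \<subseteq> ball 0 1 \<Longrightarrow> uniform_limit K (f \<circ> r) F sequentially"
    and L: "L holomorphic_on ball 0 1" "L 0 = 0"
      "\<And>u. norm u < 1 \<Longrightarrow> L u \<in> strip a b" "\<And>u. norm u < 1 \<Longrightarrow> F u = exp (L u)"
  obtains c where "norm c = 1" "\<And>u. norm u < 1 \<Longrightarrow> T (L u) = c * u"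
proof -
  define g where "g = (\<lambda>u. T (L u))"
  have g_hol: "g holomorphic_on ball 0 1" unfolding g_def
    using L(3) by (intro holomorphic_on_compose_gen[OF L(1) T_hol, unfolded o_def]) auto
  have g0: "g 0 = 0" by (simp add: g_def L T0)
  have g_disk: "norm (g u) < 1" if "norm u < 1" for u using T_disk L(3)[OF that] by (simp add: g_def)
  have le1: "norm (deriv g 0) \<le> 1"
    using Schwarz_Lemma(2)[OF g_hol g0 g_disk, of 0] by simp
  have ge: "norm (deriv g 0) \<ge> \<rho>" if \<rho>: "0 < \<rho>" "\<rho> < 1" for \<rho>
  proof -
    obtain \<kappa> where \<kappa>: "\<kappa> holomorphic_on ball 0 1" "\<And>u. norm u < 1 \<Longrightarrow> norm (\<kappa> u) \<le> norm u"
      "\<And>u. norm u < 1 \<Longrightarrow> F (\<kappa> u) = exp (E (of_real \<rho> * u))"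
      by (rule scaled_maps_subsequence[OF F r lim \<rho>]) auto
    have \<kappa>0: "\<kappa> 0 = 0" using \<kappa>(2)[of 0] by simp
    have \<kappa>_disk: "norm (\<kappa> u) < 1" if "norm u < 1" for u using \<kappa>(2)[OF that] that by simp
    have "g (\<kappa> u) = of_real \<rho> * u" if u: "norm u < 1" for u
    proof -
      have "norm (of_real \<rho> * u) \<le> \<rho>" using u \<rho> by (simp add: norm_mult mult_left_le)
      then have small: "norm (of_real \<rho> * u) < 1" using \<rho> by simp
      have "exp (L (\<kappa> u)) = exp (E (of_real \<rho> * u))"
        using L(4)[OF \<kappa>_disk[OF u]] \<kappa>(3)[OF u] by metis
      then have "L (\<kappa> u) = E (of_real \<rho> * u)"
        by (rule log_unique[OF L(3)[OF \<kappa>_disk[OF u]] E_strip[OF small]])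
      then show ?thesis using TE[OF small] by (simp add: g_def)
    qed
    then have "deriv (g \<circ> \<kappa>) 0 = deriv (\<lambda>u. of_real \<rho> * u) 0"
      by (intro deriv_cong_ev refl) (auto simp: eventually_nhds intro!: exI[of _ "ball 0 1"])
    moreover have "deriv (g \<circ> \<kappa>) 0 = deriv g 0 * deriv \<kappa> 0"
      using holomorphic_on_imp_differentiable_at[OF \<kappa>(1)] holomorphic_on_imp_differentiable_at[OF g_hol] \<kappa>0
      by (subst deriv_chain) auto
    ultimately have "\<rho> = norm (deriv g 0) * norm (deriv \<kappa> 0)"
      using \<rho> by (simp flip: norm_mult)
    moreover have "norm (deriv \<kappa> 0) \<le> 1"
      using Schwarz_Lemma(2)[OF \<kappa>(1) \<kappa>0 \<kappa>_disk, of 0] by simp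
    ultimately show ?thesis by (simp add: mult_left_le)
  qed
  have "norm (deriv g 0) \<ge> 1"
    by (rule dense_le_bounded[of 0]) (use ge in auto)
  then have "norm (deriv g 0) = 1" using le1 by simp
  then show thesis
    using Schwarz_Lemma(3)[OF g_hol g0 g_disk, of 0] that by (auto simp: g_def)
qed

text \<open>Along a subsequence \<open>X n \<circ> exp\<close> converges near \<open>0\<close> to a rotation of \<open>T\<close>. The rotation depends on the
  subsequence, but the two limits below do not see it.\<close>
theorem subsequence_invariants:
  obtains r where "strict_mono (r :: nat \<Rightarrow> nat)"
    "(\<lambda>n. norm (deriv (\<lambda>W. X (r n) (exp W)) 0)) \<longlonglongrightarrow> norm (deriv T 0)"
    "(\<lambda>n. deriv (deriv (\<lambda>W. X (r n) (exp W))) 0 / deriv (\<lambda>W. X (r n) (exp W)) 0)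
        \<longlonglongrightarrow> deriv (deriv T) 0 / deriv T 0"
proof -
  obtain F r where F: "F holomorphic_on ball 0 1" and r: "strict_mono (r :: nat \<Rightarrow> nat)"
    and lim: "\<And>K. compact K \<Longrightarrow> K \<subseteq> ball 0 1 \<Longrightarrow> uniform_limit K (f \<circ> r) F sequentially"
    using inverse_maps_subsequence by metis
  obtain L where L: "L holomorphic_on ball 0 1" "L 0 = 0"
      "\<And>u. norm u < 1 \<Longrightarrow> L u \<in> strip a b" "\<And>u. norm u < 1 \<Longrightarrow> F u = exp (L u)"
    using logarithm_of_inverse_limit[OF F r lim] by metis
  obtain c where c: "norm c = 1" "\<And>u. norm u < 1 \<Longrightarrow> T (L u) = c * u"
    using inverse_limit_is_rotation[OF F r lim L] by metis
  define k where "k = (\<lambda>n u. X n (exp (E (of_real (1/2) * u))))"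
  obtain \<kappa> s where s: "strict_mono (s :: nat \<Rightarrow> nat)" and \<kappa>: "\<kappa> holomorphic_on ball 0 1"
    and k_hol: "\<And>n. k (s n) holomorphic_on ball 0 1"
    and k_lim: "\<And>K. compact K \<Longrightarrow> K \<subseteq> ball 0 1 \<Longrightarrow> uniform_limit K (\<lambda>n. k (s n)) \<kappa> sequentially"
    and \<kappa>_le: "\<And>u. norm u < 1 \<Longrightarrow> norm (\<kappa> u) \<le> norm u"
    and F\<kappa>: "\<And>u. norm u < 1 \<Longrightarrow> F (\<kappa> u) = exp (E (of_real (1/2) * u))"
    by (rule scaled_maps_subsequence[OF F r lim, of "1/2"]) (auto simp: k_def)
  have "c \<noteq> 0" using c(1) by auto
  have \<kappa>_eq: "\<kappa> u = u / (2 * c)" if u: "norm u < 1" for u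
  proof -
    have \<kappa>1: "norm (\<kappa> u) < 1" using \<kappa>_le[OF u] u by simp
    have half: "norm (of_real (1/2) * u) < 1" using u by (simp add: norm_mult)
    have "exp (L (\<kappa> u)) = exp (E (of_real (1/2) * u))"
      using L(4)[OF \<kappa>1] F\<kappa>[OF u] by metis
    then have "L (\<kappa> u) = E (of_real (1/2) * u)"
      by (rule log_unique[OF L(3)[OF \<kappa>1] E_strip[OF half]])
    then have "c * \<kappa> u = u / 2" using c(2)[OF \<kappa>1] TE[OF half] by simp
    then show ?thesis using \<open>c \<noteq> 0\<close> by (simp add: field_simps)
  qed
  have k_derivs: "(\<lambda>n. (deriv ^^ m) (k (s n)) 0) \<longlonglongrightarrow> (deriv ^^ m) (\<lambda>u. u / (2 * c)) 0" for m
  proof (rule higher_deriv_complex_uniform_limit[where A = "ball 0 (1/2)"])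
    have "uniform_limit (cball 0 (1/2)) (\<lambda>n. k (s n)) \<kappa> sequentially" by (intro k_lim) auto
    then have "uniform_limit (ball 0 (1/2)) (\<lambda>n. k (s n)) \<kappa> sequentially"
      by (rule uniform_limit_on_subset) auto
    then show "uniform_limit (ball 0 (1/2)) (\<lambda>n. k (s n)) (\<lambda>u. u / (2 * c)) sequentially"
      by (rule uniform_limit_cong'[THEN iffD1, rotated 2]) (auto simp: \<kappa>_eq)
    show "\<forall>\<^sub>F n in sequentially. k (s n) holomorphic_on ball 0 (1/2)"
      by (intro always_eventually allI holomorphic_on_subset[OF k_hol]) auto
  qed auto
  have "deriv (\<lambda>u. u / (2 * c)) = (\<lambda>_. 1 / (2 * c))"
    by (intro ext DERIV_imp_deriv) (auto intro!: derivative_eq_intros simp: \<open>c \<noteq> 0\<close>)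
  then have k1: "(\<lambda>n. deriv (k (s n)) 0) \<longlonglongrightarrow> 1 / (2 * c)"
    and k2: "(\<lambda>n. deriv (deriv (k (s n))) 0) \<longlonglongrightarrow> 0"
    using k_derivs[of 1] k_derivs[of 2] by (simp_all add: numeral_2_eq_2)
  \<comment> \<open>On \<open>N\<close> the maps \<open>X n \<circ> exp\<close> factor through the maps \<open>k n\<close>, whose limit is known.\<close>
  define N where "N = strip a b \<inter> T -` ball 0 (1/2)"
  have "open N" unfolding N_def
    by (intro continuous_open_preimage holomorphic_on_imp_continuous_on T_hol open_strip open_ball)
  have "0 \<in> N" by (simp add: N_def zero_in_strip T0)
  have T1: "(T has_field_derivative deriv T W) (at W)" if "W \<in> N" for W
    using holomorphic_derivI[OF T_hol open_strip] that by (auto simp: N_def)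
  have T2: "(deriv T has_field_derivative deriv (deriv T) W) (at W)" if "W \<in> N" for W
    using holomorphic_derivI[OF holomorphic_deriv[OF T_hol open_strip] open_strip] that by (auto simp: N_def)
  have inner: "2 * T W \<in> ball 0 1" if "W \<in> N" for W using that by (auto simp: N_def norm_mult)
  have K1: "(k (s n) has_field_derivative deriv (k (s n)) u) (at u)" if "u \<in> ball 0 1" for u n
    using holomorphic_derivI[OF k_hol open_ball that] .
  have K2: "(deriv (k (s n)) has_field_derivative deriv (deriv (k (s n))) u) (at u)" if "u \<in> ball 0 1" for u n
    using holomorphic_derivI[OF holomorphic_deriv[OF k_hol open_ball] open_ball that] .
  let ?Y = "\<lambda>n W. X (s n) (exp W)"
  have Y: "?Y n W = k (s n) (2 * T W)" if "W \<in> N" for n W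
    using that ET[of W] by (simp add: N_def k_def)
  have Y1: "deriv (?Y n) W = deriv (k (s n)) (2 * T W) * (2 * deriv T W)" if "W \<in> N" for n W
  proof -
    have "deriv (?Y n) W = deriv (\<lambda>W. k (s n) (2 * T W)) W"
      using Y \<open>open N\<close> that by (intro deriv_cong_ev refl) (auto simp: eventually_nhds)
    also have "\<dots> = deriv (k (s n)) (2 * T W) * (2 * deriv T W)"
      using DERIV_chain2[OF K1[OF inner[OF that]] DERIV_cmult[OF T1[OF that]]] by (rule DERIV_imp_deriv)
    finally show ?thesis .
  qed
  have Y2: "deriv (deriv (?Y n)) 0 = deriv (deriv (k (s n))) 0 * (2 * deriv T 0) * (2 * deriv T 0)
      + deriv (k (s n)) 0 * (2 * deriv (deriv T) 0)" for n
  proof -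
    have "deriv (deriv (?Y n)) 0 = deriv (\<lambda>W. deriv (k (s n)) (2 * T W) * (2 * deriv T W)) 0"
      using Y1 \<open>open N\<close> \<open>0 \<in> N\<close> by (intro deriv_cong_ev refl) (auto simp: eventually_nhds)
    also have "\<dots> = deriv (deriv (k (s n))) (2 * T 0) * (2 * deriv T 0) * (2 * deriv T 0)
        + 2 * deriv (deriv T) 0 * deriv (k (s n)) (2 * T 0)"
      by (intro DERIV_imp_deriv DERIV_mult
            DERIV_chain2[OF K2[OF inner[OF \<open>0 \<in> N\<close>]] DERIV_cmult[OF T1[OF \<open>0 \<in> N\<close>]]]
            DERIV_cmult[OF T2[OF \<open>0 \<in> N\<close>]])
    finally show ?thesis by (simp add: T0)
  qed
  have "deriv T 0 \<noteq> 0"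
  proof
    assume "deriv T 0 = 0"
    have "deriv (\<lambda>W. E (T W)) 0 = deriv (\<lambda>W. W) 0"
      using ET open_strip zero_in_strip by (intro deriv_cong_ev refl) (auto simp: eventually_nhds)
    moreover have "deriv (\<lambda>W. E (T W)) 0 = deriv E (T 0) * deriv T 0"
      using DERIV_chain2[OF holomorphic_derivI[OF E_hol open_ball] T1[OF \<open>0 \<in> N\<close>]]
      by (intro DERIV_imp_deriv) (simp add: T0)
    ultimately show False using \<open>deriv T 0 = 0\<close> by simp
  qed
  show thesis
  proof (rule that[OF s])
    have "(\<lambda>n. norm (deriv (k (s n)) 0 * (2 * deriv T 0))) \<longlonglongrightarrow> norm (1 / (2 * c) * (2 * deriv T 0))"
      by (intro tendsto_intros k1)
    then show "(\<lambda>n. norm (deriv (?Y n) 0)) \<longlonglongrightarrow> norm (deriv T 0)"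
      using c(1) by (simp add: Y1[OF \<open>0 \<in> N\<close>] T0 norm_mult norm_divide)
    have "(\<lambda>n. (deriv (deriv (k (s n))) 0 * (2 * deriv T 0) * (2 * deriv T 0)
      + deriv (k (s n)) 0 * (2 * deriv (deriv T) 0)) / (deriv (k (s n)) 0 * (2 * deriv T 0)))
      \<longlonglongrightarrow> (0 * (2 * deriv T 0) * (2 * deriv T 0) + 1 / (2 * c) * (2 * deriv (deriv T) 0)) / (1 / (2 * c) * (2 * deriv T 0))"
      using \<open>c \<noteq> 0\<close> \<open>deriv T 0 \<noteq> 0\<close> by (intro tendsto_intros k1 k2) auto
    also have "(0 * (2 * deriv T 0) * (2 * deriv T 0) + 1 / (2 * c) * (2 * deriv (deriv T) 0)) / (1 / (2 * c) * (2 * deriv T 0))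
        = deriv (deriv T) 0 / deriv T 0" using \<open>c \<noteq> 0\<close> by simp
    finally show "(\<lambda>n. deriv (deriv (?Y n)) 0 / deriv (?Y n) 0) \<longlonglongrightarrow> deriv (deriv T) 0 / deriv T 0"
      by (simp add: Y1[OF \<open>0 \<in> N\<close>] Y2 T0)
  qed
qed

end

section \<open>The conformal map of the limiting strip\<close>

text \<open>
  The function \<open>W \<mapsto> exp (\<i> \<omega> + k W)\<close> maps the strip onto the right half-plane when \<open>k\<close> stretches its width
  \<open>a + b\<close> to \<open>pi\<close> and \<open>\<omega>\<close> then centres it at height \<open>0\<close>. The real axis goes to the ray of argument \<open>\<omega>\<close>, so
  \<open>\<omega>\<close> is the direction in which the trajectories will leave in the half-plane.\<close>
definition strip_exponent :: "real \<Rightarrow> real \<Rightarrow> real" where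
  "strip_exponent a b = pi / (a + b)"

definition strip_angle :: "real \<Rightarrow> real \<Rightarrow> real" where
  "strip_angle a b = strip_exponent a b * ((b - a) / 2)"

definition strip_to_hp :: "real \<Rightarrow> real \<Rightarrow> complex \<Rightarrow> complex" where
  "strip_to_hp a b W = exp (\<i> * of_real (strip_angle a b) + of_real (strip_exponent a b) * W)"

definition strip_to_disk :: "real \<Rightarrow> real \<Rightarrow> complex \<Rightarrow> complex" where
  "strip_to_disk a b W = hp_to_disk (strip_to_hp a b 0) (strip_to_hp a b W)"

definition disk_to_strip :: "real \<Rightarrow> real \<Rightarrow> complex \<Rightarrow> complex" where
  "disk_to_strip a b u =
     (Ln (disk_to_hp (strip_to_hp a b 0) u) - \<i> * of_real (strip_angle a b)) / of_real (strip_exponent a b)"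

context
  fixes a b :: real
  assumes ab: "a > 0" "b > 0"
begin

lemma strip_exponent_pos: "strip_exponent a b > 0"
  using ab by (simp add: strip_exponent_def)

lemma strip_angle_bounds:
  "strip_angle a b - strip_exponent a b * b = - (pi / 2)"
  "strip_angle a b + strip_exponent a b * a = pi / 2"
proof -
  have "strip_exponent a b * (a + b) = pi" using ab by (simp add: strip_exponent_def)
  then have *: "strip_exponent a b * a + strip_exponent a b * b = pi"
      "strip_angle a b = (strip_exponent a b * b - strip_exponent a b * a) / 2"
    by (simp_all add: strip_angle_def distrib_left right_diff_distrib)
  show "strip_angle a b - strip_exponent a b * b = - (pi / 2)" unfolding *(2) *(1)[symmetric] by (simp add: field_simps)
  show "strip_angle a b + strip_exponent a b * a = pi / 2" unfolding *(2) *(1)[symmetric] by (simp add: field_simps)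
qed

lemma abs_strip_angle: "\<bar>strip_angle a b\<bar> < pi / 2"
  using strip_angle_bounds mult_pos_pos[OF strip_exponent_pos ab(1)] mult_pos_pos[OF strip_exponent_pos ab(2)]
  by linarith

lemma cos_strip_angle_pos: "cos (strip_angle a b) > 0"
  using abs_strip_angle by (intro cos_gt_zero_pi) auto

lemma strip_scaled_Im:
  assumes "W \<in> strip a b"
  shows "\<bar>strip_angle a b + strip_exponent a b * Im W\<bar> < pi / 2"
proof -
  have "strip_exponent a b * Im W < strip_exponent a b * a"
    "strip_exponent a b * - b < strip_exponent a b * Im W"
    using assms strip_exponent_pos unfolding strip_def by (intro mult_strict_left_mono; simp)+
  then show ?thesis using strip_angle_bounds by linarith
qed

lemma Re_strip_to_hp:
  assumes "W \<in> strip a b" shows "Re (strip_to_hp a b W) > 0"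
proof -
  have "cos (strip_angle a b + strip_exponent a b * Im W) > 0"
    by (rule cos_gt_zero_pi) (use strip_scaled_Im[OF assms] in linarith)+
  then show ?thesis by (simp add: strip_to_hp_def Re_exp)
qed

lemma zero_strip: "0 \<in> strip a b"
  using ab by (simp add: strip_def)

lemma strip_to_hp_holomorphic: "strip_to_hp a b holomorphic_on S"
  unfolding strip_to_hp_def by (intro holomorphic_intros)

lemma strip_to_disk_holomorphic: "strip_to_disk a b holomorphic_on strip a b"
  unfolding strip_to_disk_def
  by (intro holomorphic_on_hp_to_disk strip_to_hp_holomorphic Re_strip_to_hp zero_strip)

lemma norm_strip_to_disk: "W \<in> strip a b \<Longrightarrow> norm (strip_to_disk a b W) < 1"
  unfolding strip_to_disk_def by (intro norm_hp_to_disk Re_strip_to_hp zero_strip)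

lemma disk_to_strip_holomorphic: "disk_to_strip a b holomorphic_on ball 0 1"
proof -
  have "disk_to_hp (strip_to_hp a b 0) u \<notin> \<real>\<^sub>\<le>\<^sub>0" if "u \<in> ball 0 1" for u
    using Re_disk_to_hp[OF Re_strip_to_hp[OF zero_strip], of u] that by (auto simp: complex_nonpos_Reals_iff)
  then show ?thesis unfolding disk_to_strip_def using strip_exponent_pos
    by (intro holomorphic_intros holomorphic_on_disk_to_hp) auto
qed

lemma disk_to_strip_in_strip:
  assumes "norm u < 1" shows "disk_to_strip a b u \<in> strip a b"
proof -
  let ?z = "disk_to_hp (strip_to_hp a b 0) u"
  have pos: "Re ?z > 0" by (rule Re_disk_to_hp[OF Re_strip_to_hp[OF zero_strip] assms])
  then have "\<bar>Im (Ln ?z)\<bar> < pi / 2" using Re_Ln_pos_lt[of ?z] by force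
  then have "- (strip_exponent a b * b) < Im (Ln ?z) - strip_angle a b"
    "Im (Ln ?z) - strip_angle a b < strip_exponent a b * a"
    using strip_angle_bounds by (simp_all add: abs_less_iff)
  then show ?thesis
    using strip_exponent_pos by (simp add: strip_def disk_to_strip_def field_simps)
qed

lemma disk_to_strip_to_disk:
  assumes "W \<in> strip a b" shows "disk_to_strip a b (strip_to_disk a b W) = W"
proof -
  have "disk_to_hp (strip_to_hp a b 0) (strip_to_disk a b W) = strip_to_hp a b W"
    unfolding strip_to_disk_def by (intro disk_to_hp_to_disk Re_strip_to_hp zero_strip assms)
  moreover have "Ln (strip_to_hp a b W) = \<i> * of_real (strip_angle a b) + of_real (strip_exponent a b) * W"
    unfolding strip_to_hp_def
  proof (rule Ln_exp)
    let ?z = "\<i> * of_real (strip_angle a b) + of_real (strip_exponent a b) * W"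
    have "Im ?z = strip_angle a b + strip_exponent a b * Im W" by simp
    then show "- pi < Im ?z" "Im ?z \<le> pi" using strip_scaled_Im[OF assms] pi_gt_zero by linarith+
  qed
  ultimately show ?thesis using strip_exponent_pos by (simp add: disk_to_strip_def)
qed

lemma strip_to_disk_to_strip:
  assumes "norm u < 1" shows "strip_to_disk a b (disk_to_strip a b u) = u"
proof -
  let ?z = "disk_to_hp (strip_to_hp a b 0) u"
  have pos: "Re ?z > 0" by (rule Re_disk_to_hp[OF Re_strip_to_hp[OF zero_strip] assms])
  then have "?z \<noteq> 0" by auto
  then have "strip_to_hp a b (disk_to_strip a b u) = ?z"
    using strip_exponent_pos by (simp add: strip_to_hp_def disk_to_strip_def)
  then show ?thesis
    unfolding strip_to_disk_def using hp_to_disk_to_hp[OF Re_strip_to_hp[OF zero_strip] assms] by simp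
qed

lemma strip_to_disk_0: "strip_to_disk a b 0 = 0"
  by (simp add: strip_to_disk_def)

text \<open>The invariants of the model: \<open>R'' / R' - R' / Re R\<close> for \<open>R W = exp (\<i> \<omega> + k W)\<close> is \<open>k - k cis \<omega> / cos \<omega>\<close> at \<open>0\<close>. It is
  purely imaginary because its real part is the logarithmic derivative of the hyperbolic density along the real
  axis, and translations along that axis are isometries of the strip.\<close>
lemma strip_to_disk_invariants:
  "norm (deriv (strip_to_disk a b) 0) = strip_exponent a b / (2 * cos (strip_angle a b))"
  "deriv (deriv (strip_to_disk a b)) 0 / deriv (strip_to_disk a b) 0
     = - \<i> * of_real (strip_exponent a b * tan (strip_angle a b))"
proof -
  define k where "k = complex_of_real (strip_exponent a b)"
  define \<omega> where "\<omega> = strip_angle a b"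
  have R1: "deriv (strip_to_hp a b) W = k * strip_to_hp a b W" for W
    unfolding strip_to_hp_def k_def by (rule DERIV_imp_deriv) (auto intro!: derivative_eq_intros)
  have R2: "deriv (deriv (strip_to_hp a b)) W = k * (k * strip_to_hp a b W)" for W
  proof -
    have "deriv (\<lambda>W. k * strip_to_hp a b W) W = k * (k * strip_to_hp a b W)"
      unfolding strip_to_hp_def k_def by (rule DERIV_imp_deriv) (auto intro!: derivative_eq_intros)
    then show ?thesis using R1 by presburger
  qed
  have R0: "strip_to_hp a b 0 = cis \<omega>" by (simp add: strip_to_hp_def \<omega>_def cis_conv_exp)
  have x: "Re (strip_to_hp a b 0) = cos \<omega>" by (simp add: R0)
  have cos: "cos \<omega> > 0" using cos_strip_angle_pos by (simp add: \<omega>_def)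
  have k: "k \<noteq> 0" using strip_exponent_pos by (simp add: k_def)
  note D = deriv_hp_to_disk[OF strip_to_hp_holomorphic open_strip zero_strip Re_strip_to_hp, folded strip_to_disk_def]
  have D1: "deriv (strip_to_disk a b) 0 = k * cis \<omega> / (2 * of_real (cos \<omega>))"
    using D(1) unfolding x R1 R0 by simp
  have D2: "deriv (deriv (strip_to_disk a b)) 0
      = k * (k * cis \<omega>) / (2 * of_real (cos \<omega>)) - (k * cis \<omega>)\<^sup>2 / (2 * (of_real (cos \<omega>))\<^sup>2)"
    using D(2) unfolding x R1 R2 R0 by simp
  show "norm (deriv (strip_to_disk a b) 0) = strip_exponent a b / (2 * cos (strip_angle a b))"
    unfolding D1 using cos strip_exponent_pos by (simp add: norm_mult norm_divide k_def \<omega>_def)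
  have "deriv (deriv (strip_to_disk a b)) 0 / deriv (strip_to_disk a b) 0
      = k - k * cis \<omega> / of_real (cos \<omega>)"
    unfolding D1 D2 using cos k by (simp add: field_simps power2_eq_square)
  also have "\<dots> = - \<i> * of_real (strip_exponent a b * tan (strip_angle a b))"
    using cos by (simp add: k_def \<omega>_def[symmetric] complex_eq_iff tan_def Re_divide_of_real Im_divide_of_real)
  finally show "deriv (deriv (strip_to_disk a b)) 0 / deriv (strip_to_disk a b) 0
     = - \<i> * of_real (strip_exponent a b * tan (strip_angle a b))" .
qed

end

section \<open>Angular extents and the shape of the domain at infinity\<close>

text \<open>
  The common core of the two angular extents: the length, cut off at \<open>pi\<close>, of the longest initial piece of
  \<open>[0, \<infinity>)\<close> that is contained in \<open>U\<close>.\<close>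
definition initial_extent :: "real set \<Rightarrow> real" where
  "initial_extent U = real_of_ereal (min (ereal pi) (SUP \<alpha>\<in>{\<alpha>. \<alpha> > 0 \<and> (\<forall>\<theta>\<in>{0..\<alpha>}. \<theta> \<in> U)}. ereal \<alpha>))"

lemma left_angular_extent_eq:
  "left_angular_extent \<Omega> p t = initial_extent {\<theta>. p + \<i> * of_real t * cis (1 * \<theta>) \<in> \<Omega>}"
  by (simp add: left_angular_extent_def initial_extent_def)

lemma right_angular_extent_eq:
  "right_angular_extent \<Omega> p t = initial_extent {\<theta>. p + \<i> * of_real t * cis ((-1) * \<theta>) \<in> \<Omega>}"
  by (simp add: right_angular_extent_def initial_extent_def)

lemma initial_extent_le_pi: "initial_extent U \<le> pi"
proof -
  have "min (ereal pi) (SUP \<alpha>\<in>{\<alpha>. \<alpha> > 0 \<and> (\<forall>\<theta>\<in>{0..\<alpha>}. \<theta> \<in> U)}. ereal \<alpha>) \<le> ereal pi" by simp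
  then show ?thesis unfolding initial_extent_def
    by (metis (no_types, lifting) MInfty_neq_ereal(1) PInfty_neq_ereal(1) ereal_less_eq(3) less_ereal.simps(1) linorder_not_le order_le_less pi_ge_zero real_of_ereal.elims)
qed

lemma less_initial_extent_mem:
  assumes "0 \<le> \<theta>" "\<theta> < initial_extent U" shows "\<theta> \<in> U"
proof -
  let ?A = "{\<alpha>. \<alpha> > 0 \<and> (\<forall>\<theta>\<in>{0..\<alpha>}. \<theta> \<in> U)}"
  have "ereal \<theta> < (SUP \<alpha>\<in>?A. ereal \<alpha>)"
  proof (rule ccontr)
    assume "\<not> ereal \<theta> < (SUP \<alpha>\<in>?A. ereal \<alpha>)"
    then have "min (ereal pi) (SUP \<alpha>\<in>?A. ereal \<alpha>) \<le> ereal \<theta>" by (simp add: not_less min.coboundedI2)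
    then have "initial_extent U \<le> \<theta>" unfolding initial_extent_def
      using assms(1) by (cases "min (ereal pi) (SUP \<alpha>\<in>?A. ereal \<alpha>)") auto
    with assms(2) show False by simp
  qed
  then obtain \<alpha> where "\<alpha> \<in> ?A" "\<theta> < \<alpha>" by (auto simp: less_SUP_iff)
  then show ?thesis using assms(1) by auto
qed

lemma initial_extent_notin:
  assumes "open U" "0 \<in> U" "initial_extent U < pi" shows "initial_extent U \<notin> U"
proof
  let ?A = "{\<alpha>. \<alpha> > 0 \<and> (\<forall>\<theta>\<in>{0..\<alpha>}. \<theta> \<in> U)}"
  define s where "s = initial_extent U"
  assume "initial_extent U \<in> U"
  then obtain e where e: "e > 0" "\<And>y. \<bar>y - s\<bar> < e \<Longrightarrow> y \<in> U"
    using \<open>open U\<close> unfolding open_real_def s_def by (metis dist_real_def open_dist \<open>open U\<close>)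
  obtain d where d: "d > 0" "\<And>y. \<bar>y - 0\<bar> < d \<Longrightarrow> y \<in> U"
    using \<open>open U\<close> \<open>0 \<in> U\<close> by (metis dist_real_def open_dist)
  have "d / 2 \<in> ?A" using d by auto
  then have "ereal (d / 2) \<le> (SUP \<alpha>\<in>?A. ereal \<alpha>)" by (intro SUP_upper) auto
  then have pos: "min (ereal pi) (SUP \<alpha>\<in>?A. ereal \<alpha>) > 0"
    using d(1) by (auto simp: min_def intro: less_le_trans[of 0 "ereal (d/2)"])
  then have "s \<ge> 0" unfolding s_def initial_extent_def by (simp add: real_of_ereal_pos)
  have "s + e / 2 \<in> ?A"
  proof -
    have "\<theta> \<in> U" if "0 \<le> \<theta>" "\<theta> \<le> s + e / 2" for \<theta>
    proof (cases "\<theta> < s")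
      case True then show ?thesis using less_initial_extent_mem that by (simp add: s_def)
    next
      case False then show ?thesis using e that by auto
    qed
    then show ?thesis using \<open>s \<ge> 0\<close> \<open>e > 0\<close> by auto
  qed
  then have "ereal (s + e / 2) \<le> (SUP \<alpha>\<in>?A. ereal \<alpha>)" by (intro SUP_upper) auto
  moreover have "ereal s < ereal (s + e / 2)" using \<open>e > 0\<close> by simp
  ultimately have "ereal s < (SUP \<alpha>\<in>?A. ereal \<alpha>)" by (rule less_le_trans[rotated])
  then have "ereal s < min (ereal pi) (SUP \<alpha>\<in>?A. ereal \<alpha>)"
    using assms(3) unfolding min_less_iff_conj by (simp add: s_def)
  moreover have "min (ereal pi) (SUP \<alpha>\<in>?A. ereal \<alpha>) = ereal s"
  proof -
    have "min (ereal pi) (SUP \<alpha>\<in>?A. ereal \<alpha>) \<le> ereal pi" by simp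
    then show ?thesis using pos unfolding s_def initial_extent_def
      by (cases "min (ereal pi) (SUP \<alpha>\<in>?A. ereal \<alpha>)") auto
  qed
  ultimately show False by simp
qed

text \<open>Every point of the boundary ray of direction \<open>\<sigma> * \<alpha>\<close> is a limit of points outside the rescaled domain. If
  \<open>\<alpha> < pi\<close>, the endpoints of the arcs that define the extents do this. If \<open>\<alpha> = pi\<close>, the extents may
  equal \<open>pi\<close> with no such endpoint; instead, the half-line below a point \<open>w0\<close> outside \<open>\<Omega>\<close>
  avoids \<open>\<Omega>\<close>, and after rescaling it converges to the negative real axis. The vertex \<open>c\<close> of the dilations may
  differ from \<open>p\<close>, since the difference is scaled away.\<close>
lemma ray_limit_of_omitted_points:
  fixes \<sigma> :: real and \<Omega> :: "complex set" and p c :: complex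
  defines "ext \<equiv> \<lambda>t. initial_extent {\<theta>. p + \<i> * complex_of_real t * cis (\<sigma> * \<theta>) \<in> \<Omega>}"
  assumes "open \<Omega>" and up: "\<And>w t. w \<in> \<Omega> \<Longrightarrow> t \<ge> 0 \<Longrightarrow> w + \<i> * of_real t \<in> \<Omega>" and w0: "w0 \<notin> \<Omega>"
    and p: "\<forall>\<^sub>F t in at_top. p + \<i> * of_real t \<in> \<Omega>"
    and lim: "(ext \<longlongrightarrow> \<alpha>) at_top" and \<sigma>: "\<bar>\<sigma>\<bar> = 1"
  shows "\<exists>\<beta>. (\<forall>\<^sub>F t in at_top. c + \<i> * of_real t * \<beta> t \<notin> \<Omega>) \<and> (\<beta> \<longlongrightarrow> exp (Complex x (\<sigma> * \<alpha>))) at_top"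
proof -
  have inv_lim: "((\<lambda>t. z / (\<i> * complex_of_real t)) \<longlongrightarrow> 0) at_top" for z
  proof (rule tendsto_divide_0[OF tendsto_const])
    show "filterlim (\<lambda>t. \<i> * complex_of_real t) at_infinity at_top"
      by (intro tendsto_mult_filterlim_at_infinity[OF tendsto_const] filterlim_of_real_at_infinity) auto
  qed
  have ext_le: "ext t \<le> pi" for t unfolding ext_def by (rule initial_extent_le_pi)
  have "\<alpha> \<le> pi" by (rule tendsto_upperbound[OF lim]) (use ext_le in auto)
  have exp_cis: "exp (Complex x y) = of_real (exp x) * cis y" for y
    by (simp add: exp_eq_polar)
  have scaled: "filterlim (\<lambda>t. t * exp x) at_top at_top"
    by (intro filterlim_at_top_mult_tendsto_pos[OF tendsto_const]) (auto simp: filterlim_ident)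
  show ?thesis
  proof (cases "\<alpha> < pi")
    case True
    define \<beta> where "\<beta> = (\<lambda>t. (p - c) / (\<i> * of_real t) + of_real (exp x) * cis (\<sigma> * ext (t * exp x)))"
    have "\<forall>\<^sub>F t in at_top. p + \<i> * of_real t * cis (\<sigma> * ext t) \<notin> \<Omega>"
      using order_tendstoD(2)[OF lim True] p
    proof eventually_elim
      case (elim t)
      have "open ((\<lambda>\<theta>. p + \<i> * complex_of_real t * cis (\<sigma> * \<theta>)) -` \<Omega>)"
        using \<open>open \<Omega>\<close> by (intro open_vimage) (auto intro!: continuous_intros)
      then have "initial_extent {\<theta>. p + \<i> * of_real t * cis (\<sigma> * \<theta>) \<in> \<Omega>} \<notin> {\<theta>. p + \<i> * of_real t * cis (\<sigma> * \<theta>) \<in> \<Omega>}"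
        using elim by (intro initial_extent_notin) (auto simp: vimage_def ext_def)
      then show ?case by (simp add: ext_def)
    qed
    then have "\<forall>\<^sub>F t in at_top. p + \<i> * of_real (t * exp x) * cis (\<sigma> * ext (t * exp x)) \<notin> \<Omega>"
      using scaled by (rule eventually_compose_filterlim)
    then have "\<forall>\<^sub>F t in at_top. c + \<i> * of_real t * \<beta> t \<notin> \<Omega>"
      using eventually_gt_at_top[of 0]
    proof eventually_elim
      case (elim t)
      have "c + \<i> * of_real t * \<beta> t = p + \<i> * of_real (t * exp x) * cis (\<sigma> * ext (t * exp x))"
        using \<open>t > 0\<close> by (simp add: \<beta>_def field_simps)
      then show ?case using elim by simp
    qed
    moreover have "(\<beta> \<longlongrightarrow> 0 + of_real (exp x) * cis (\<sigma> * \<alpha>)) at_top"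
      unfolding \<beta>_def by (intro tendsto_intros inv_lim filterlim_compose[OF lim scaled])
    ultimately show ?thesis by (intro exI[of _ \<beta>]) (simp add: exp_cis)
  next
    case False
    then have "\<alpha> = pi" using \<open>\<alpha> \<le> pi\<close> by simp
    have "cis (\<sigma> * pi) = -1" using \<sigma> by (auto simp: abs_if complex_eq_iff split: if_splits)
    define \<beta> where "\<beta> = (\<lambda>t. (w0 - c) / (\<i> * of_real t) - of_real (exp x))"
    have "\<forall>\<^sub>F t in at_top. c + \<i> * of_real t * \<beta> t \<notin> \<Omega>"
      using eventually_gt_at_top[of 0]
    proof eventually_elim
      case (elim t)
      have "w0 = (c + \<i> * of_real t * \<beta> t) + \<i> * of_real (t * exp x)"
        using elim by (simp add: \<beta>_def field_simps)
      then show ?case using up[of "c + \<i> * of_real t * \<beta> t" "t * exp x"] w0 elim by auto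
    qed
    moreover have "(\<beta> \<longlongrightarrow> 0 - of_real (exp x)) at_top"
      unfolding \<beta>_def by (intro tendsto_intros inv_lim)
    ultimately show ?thesis
      using \<open>cis (\<sigma> * pi) = -1\<close> by (intro exI[of _ \<beta>]) (simp add: exp_cis \<open>\<alpha> = pi\<close>)
  qed
qed

text \<open>A point \<open>W\<close> of \<open>K\<close> keeps a distance of at least \<open>2 * \<delta>\<close> from the boundary of the strip. Replacing the vertex \<open>c\<close> by \<open>p\<close>
  moves it by less than \<open>\<delta>\<close> when \<open>t\<close> is large, and then it lies on an arc of angle less than the angular extent at its
  radius \<open>t * exp (Re W')\<close>.\<close>
lemma compact_subset_of_strip_eventually_inside:
  assumes left: "(left_angular_extent \<Omega> p \<longlongrightarrow> a) at_top" and right: "(right_angular_extent \<Omega> p \<longlongrightarrow> b) at_top"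
    and K: "compact K" "K \<subseteq> strip a b"
  shows "\<forall>\<^sub>F t in at_top. \<forall>W\<in>K. c + \<i> * of_real t * exp W \<in> \<Omega>"
proof (cases "K = {}")
  case False
  obtain W1 where W1: "W1 \<in> K" "\<And>W. W \<in> K \<Longrightarrow> Im W \<le> Im W1"
    using continuous_attains_sup[OF K(1) False continuous_on_Im[OF continuous_on_id]] by auto
  obtain W2 where W2: "W2 \<in> K" "\<And>W. W \<in> K \<Longrightarrow> Im W2 \<le> Im W"
    using continuous_attains_inf[OF K(1) False continuous_on_Im[OF continuous_on_id]] by auto
  define \<delta> where "\<delta> = min (a - Im W1) (Im W2 + b) / 2"
  have "\<delta> > 0" using W1(1) W2(1) K(2) by (auto simp: \<delta>_def strip_def)
  have \<delta>: "Im W \<le> a - 2 * \<delta>" "Im W \<ge> - b + 2 * \<delta>" if "W \<in> K" for W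
    using W1(2)[OF that] W2(2)[OF that] by (auto simp: \<delta>_def min_def)
  obtain X where X: "\<And>W. W \<in> K \<Longrightarrow> norm W \<le> X"
    using compact_imp_bounded[OF K(1)] by (auto simp: bounded_iff)
  have ReX: "- X \<le> Re W" if "W \<in> K" for W using X[OF that] abs_Re_le_cmod[of W] by linarith
  have "isCont (\<lambda>z. Ln (1 + z)) 0"
    by (intro continuous_intros) (simp add: complex_nonpos_Reals_iff)
  then have "((\<lambda>z. Ln (1 + z)) \<longlongrightarrow> 0) (at 0)" by (simp add: isCont_def)
  then have "\<forall>\<^sub>F z in at 0. norm (Ln (1 + z)) < min \<delta> 1"
    using \<open>\<delta> > 0\<close> by (auto dest: tendstoD[of _ _ _ "min \<delta> 1"])
  then obtain d where d: "d > 0" "\<And>z. z \<noteq> 0 \<Longrightarrow> norm z < d \<Longrightarrow> norm (Ln (1 + z)) < min \<delta> 1"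
    by (auto simp: eventually_at)
  define \<epsilon> where "\<epsilon> = min d 1"
  have "\<epsilon> > 0" "\<epsilon> \<le> 1" using d by (auto simp: \<epsilon>_def)
  have \<epsilon>: "norm (Ln (1 + z)) < min \<delta> 1" if "norm z < \<epsilon>" for z
    using d(2)[of z] that \<open>\<delta> > 0\<close> by (cases "z = 0") (auto simp: \<epsilon>_def)
  define A where "A = (c - p) / \<i>"
  have "\<forall>\<^sub>F t in at_top. a - \<delta> < left_angular_extent \<Omega> p t \<and> b - \<delta> < right_angular_extent \<Omega> p t"
    using order_tendstoD(1)[OF left, of "a - \<delta>"] order_tendstoD(1)[OF right, of "b - \<delta>"] \<open>\<delta> > 0\<close>
    by (auto intro: eventually_conj)
  then obtain t1 where t1: "\<And>t. t \<ge> t1 \<Longrightarrow> a - \<delta> < left_angular_extent \<Omega> p t \<and> b - \<delta> < right_angular_extent \<Omega> p t"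
    unfolding eventually_at_top_linorder by blast
  \<comment> \<open>The bound with \<open>t1\<close> makes the radius \<open>t'\<close> exceed \<open>t1\<close>, the last one makes the displacement less than \<open>\<epsilon>\<close>.\<close>
  define t2 where "t2 = max (max 1 (t1 * exp (X + 1))) (norm A * exp X / \<epsilon> + 1)"
  have "c + \<i> * of_real t * exp W \<in> \<Omega>" if t: "t \<ge> t2" and W: "W \<in> K" for t W
  proof -
    have "t > 0" using t by (simp add: t2_def)
    define z where "z = A * exp (- W) / of_real t"
    have "norm z \<le> norm A * exp X / t"
      using ReX[OF W] \<open>t > 0\<close> by (auto simp: z_def norm_mult norm_divide intro!: divide_right_mono mult_left_mono)
    also have "\<dots> < \<epsilon>" using t \<open>\<epsilon> > 0\<close> \<open>t > 0\<close> by (simp add: t2_def field_simps)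
    finally have "norm z < \<epsilon>" .
    then have ln: "norm (Ln (1 + z)) < min \<delta> 1" by (rule \<epsilon>)
    define W' where "W' = W + Ln (1 + z)"
    have "1 + z \<noteq> 0" using \<open>norm z < \<epsilon>\<close> \<open>\<epsilon> \<le> 1\<close> by (auto simp: add_eq_0_iff)
    have Im': "\<bar>Im W' - Im W\<bar> < \<delta>" and Re': "\<bar>Re W' - Re W\<bar> < 1"
      using ln abs_Im_le_cmod[of "Ln (1 + z)"] abs_Re_le_cmod[of "Ln (1 + z)"] by (auto simp: W'_def)
    define t' where "t' = t * exp (Re W')"
    have "exp W' = exp W * (1 + z)" using \<open>1 + z \<noteq> 0\<close> by (simp add: W'_def exp_add)
    also have "\<dots> = exp W + A / of_real t" by (simp add: z_def algebra_simps exp_minus_inverse flip: exp_add)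
    finally have eW': "exp W' = exp W + A / of_real t" .
    have "c + \<i> * of_real t * exp W = p + \<i> * of_real t * exp W'"
      using \<open>t > 0\<close> by (simp add: eW' A_def field_simps)
    also have "\<dots> = p + \<i> * of_real t' * cis (Im W')"
      by (simp add: t'_def exp_eq_polar mult.assoc exp_of_real)
    finally have pt: "c + \<i> * of_real t * exp W = p + \<i> * of_real t' * cis (Im W')" .
    have "t1 \<le> t'"
    proof (cases "t1 \<le> 0")
      case True then show ?thesis using \<open>t > 0\<close> by (auto simp: t'_def intro: order_trans)
    next
      case False
      have "t1 = t1 * exp (X + 1) * exp (- (X + 1))" by (simp flip: exp_add)
      also have "\<dots> \<le> t * exp (Re W')"
        using t ReX[OF W] Re' False \<open>t > 0\<close> by (intro mult_mono) (auto simp: t2_def)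
      finally show ?thesis by (simp add: t'_def)
    qed
    note ext = t1[OF this]
    show ?thesis
    proof (cases "Im W' \<ge> 0")
      case True
      have "Im W' < left_angular_extent \<Omega> p t'" using ext \<delta>(1)[OF W] Im' by linarith
      then show ?thesis
        using less_initial_extent_mem[OF True] unfolding left_angular_extent_eq pt by force
    next
      case False
      have "- Im W' < right_angular_extent \<Omega> p t'" using ext \<delta>(2)[OF W] Im' by linarith
      then show ?thesis
        using less_initial_extent_mem[of "- Im W'"] False unfolding right_angular_extent_eq pt by force
    qed
  qed
  then show ?thesis unfolding eventually_at_top_linorder by blast
qed auto

section \<open>Curves of asymptotically constant geodesic curvature\<close>

lemma barrier_above:
  fixes f f' :: "real \<Rightarrow> real"
  assumes der: "\<And>s. s \<ge> s0 \<Longrightarrow> (f has_real_derivative f' s) (at s)"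
    and inward: "\<And>s. s \<ge> s0 \<Longrightarrow> f s = M \<Longrightarrow> f' s < 0"
    and start: "f s0 \<le> M" and "s0 \<le> s"
  shows "f s \<le> M"
proof (rule ccontr)
  assume "\<not> f s \<le> M"
  then have fs: "f s > M" by simp
  have cont: "continuous_on {s0..s} f"
    using der by (intro DERIV_continuous_on[where D = f']) (auto intro: has_field_derivative_at_within)
  define S where "S = {u \<in> {s0..s}. f u \<le> M}"
  have "S = {s0..s} \<inter> f -` {..M}" by (auto simp: S_def)
  then have "closed S"
    using continuous_on_closed_vimage[of "{s0..s}" f] cont by (metis closed_atLeastAtMost closed_atMost inf_commute)
  moreover have "S \<subseteq> {s0..s}" by (auto simp: S_def)
  ultimately have "compact S"
    by (meson bounded_closed_interval bounded_subset compact_eq_bounded_closed)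
  moreover have "S \<noteq> {}" using start \<open>s0 \<le> s\<close> by (auto simp: S_def)
  ultimately obtain u where u: "u \<in> S" "\<And>v. v \<in> S \<Longrightarrow> v \<le> u"
    using compact_attains_sup[of S] by metis
  have us: "s0 \<le> u" "u < s" "f u \<le> M" using u(1) fs by (auto simp: S_def order_le_less)
  have after: "f v > M" if "u < v" "v \<le> s" for v
    using u(2)[of v] that us by (force simp: S_def)
  have "f u = M"
  proof (rule ccontr)
    assume "f u \<noteq> M"
    then have "f u < M" using us by simp
    have "continuous_on {u..s} f" using cont by (rule continuous_on_subset) (use us in auto)
    then obtain v where "u \<le> v" "v \<le> s" "f v = M"
      using IVT'[of f u M s] \<open>f u < M\<close> fs us by auto
    with after[of v] \<open>f u < M\<close> show False by (cases "v = u") auto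
  qed
  with inward us have "f' u < 0" by simp
  then obtain d where "d > 0" and d: "\<And>h. h > 0 \<Longrightarrow> h < d \<Longrightarrow> f u > f (u + h)"
    using DERIV_neg_dec_right[OF der[OF us(1)]] by blast
  define h where "h = min (d/2) (s - u)"
  have "h > 0" "h < d" "u + h \<le> s" using \<open>d > 0\<close> us by (auto simp: h_def)
  with d[of h] after[of "u + h"] \<open>f u = M\<close> show False by auto
qed

lemma uniform_drift_escapes:
  fixes f f' :: "real \<Rightarrow> real"
  assumes der: "\<And>s. s \<ge> s0 \<Longrightarrow> (f has_real_derivative f' s) (at s)"
    and drift: "\<And>s. s \<ge> s0 \<Longrightarrow> L \<le> f s \<Longrightarrow> f s \<le> U \<Longrightarrow> f' s \<ge> m"
    and "m > 0" "L \<le> U" "L \<le> f s0"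
  shows "\<exists>s\<ge>s0. f s > U"
proof (rule ccontr)
  assume "\<not> ?thesis"
  then have up: "f s \<le> U" if "s \<ge> s0" for s using that by force
  have lo: "f s \<ge> L" if "s \<ge> s0" for s
    using barrier_above[of s0 "\<lambda>s. - f s" "\<lambda>s. - f' s" "- L" s] der drift assms that
    by (force intro!: derivative_eq_intros)
  define s where "s = s0 + (U - f s0) / m + 1"
  have "s \<ge> s0" using up[of s0] \<open>m > 0\<close> by (simp add: s_def)
  have "f s0 - m * s0 \<le> f s - m * s"
  proof (rule DERIV_nonneg_imp_nondecreasing[OF \<open>s \<ge> s0\<close>])
    fix x assume "s0 \<le> x" "x \<le> s"
    then show "\<exists>y. ((\<lambda>s. f s - m * s) has_real_derivative y) (at x) \<and> 0 \<le> y"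
      by (intro exI[of _ "f' x - m"]) (auto intro!: derivative_eq_intros der simp: drift lo up)
  qed
  moreover have "m * s = m * s0 + (U - f s0) + m" using \<open>m > 0\<close> by (simp add: s_def field_simps)
  ultimately show False using up[OF \<open>s \<ge> s0\<close>] \<open>m > 0\<close> by linarith
qed

text \<open>For the equation \<open>E' = a E\<close> with \<open>a \<ge> a1 > 0\<close> the equilibrium \<open>0\<close> is repelling, also under small errors: once
  \<open>\<bar>E\<bar> \<ge> e\<close> at a late time, \<open>\<bar>E\<bar>\<close> grows at least linearly. A bounded solution must therefore tend to \<open>0\<close>.\<close>
lemma unstable_bounded_tendsto_0:
  fixes E E' a :: "real \<Rightarrow> real"
  assumes der: "\<And>s. s \<ge> s0 \<Longrightarrow> (E has_real_derivative E' s) (at s)"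
    and eq: "((\<lambda>s. E' s - a s * E s) \<longlongrightarrow> 0) at_top"
    and "a1 > 0" and a: "\<forall>\<^sub>F s in at_top. a s \<ge> a1"
    and bd: "\<And>s. s \<ge> s0 \<Longrightarrow> \<bar>E s\<bar> \<le> B"
  shows "(E \<longlongrightarrow> 0) at_top"
proof -
  have upper: "\<forall>\<^sub>F s in at_top. E s < e"
    if "e > 0" and der: "\<And>s. s \<ge> s0 \<Longrightarrow> (E has_real_derivative E' s) (at s)"
      and eq: "((\<lambda>s. E' s - a s * E s) \<longlongrightarrow> 0) at_top"
      and bd: "\<And>s. s \<ge> s0 \<Longrightarrow> \<bar>E s\<bar> \<le> B" for E E' :: "real \<Rightarrow> real" and e :: real
  proof -
    define m where "m = a1 * e / 2"
    have "m > 0" using that \<open>a1 > 0\<close> by (simp add: m_def)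
    have "\<forall>\<^sub>F s in at_top. \<bar>E' s - a s * E s\<bar> < m"
      using tendstoD[OF eq \<open>m > 0\<close>] by (simp add: dist_real_def)
    then have "\<forall>\<^sub>F s in at_top. \<bar>E' s - a s * E s\<bar> < m \<and> a s \<ge> a1 \<and> s \<ge> s0"
      using a eventually_ge_at_top[of s0] by eventually_elim auto
    then obtain s1 where s1: "\<And>s. s \<ge> s1 \<Longrightarrow> \<bar>E' s - a s * E s\<bar> < m \<and> a s \<ge> a1 \<and> s \<ge> s0"
      by (auto simp: eventually_at_top_linorder)
    have "E s < e" if "s \<ge> s1" for s
    proof (rule ccontr)
      assume "\<not> E s < e"
      then have Es: "e \<le> E s" by simp
      have "\<exists>s'\<ge>s. E s' > max B e"
      proof (rule uniform_drift_escapes[where f' = E' and m = m and L = e])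
        show "E' u \<ge> m" if "u \<ge> s" "e \<le> E u" for u
        proof -
          have u: "u \<ge> s1" using that \<open>s \<ge> s1\<close> by simp
          have "a u * E u \<ge> a1 * e"
            using s1[OF u] that \<open>a1 > 0\<close> \<open>e > 0\<close> by (intro mult_mono) auto
          moreover have "E' u - a u * E u > - m" using s1[OF u] by linarith
          moreover have "a1 * e = 2 * m" by (simp add: m_def)
          ultimately show ?thesis by linarith
        qed
        show "(E has_real_derivative E' u) (at u)" if "u \<ge> s" for u
          using s1[of u] that \<open>s \<ge> s1\<close> by (intro der) auto
      qed (use Es \<open>m > 0\<close> in auto)
      then obtain s' where "s' \<ge> s" "E s' > B" by auto
      with bd[of s'] s1[of s'] \<open>s \<ge> s1\<close> show False by auto
    qed
    then show ?thesis by (auto simp: eventually_at_top_linorder)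
  qed
  show ?thesis
  proof (rule tendstoI)
    fix e :: real assume "e > 0"
    have "\<forall>\<^sub>F s in at_top. - E s < e"
      using tendsto_minus[OF eq] der bd
      by (intro upper[OF \<open>e > 0\<close>, where E' = "\<lambda>s. - E' s"])
         (auto intro!: derivative_eq_intros simp: algebra_simps)
    moreover have "\<forall>\<^sub>F s in at_top. E s < e"
      using der eq bd by (intro upper[OF \<open>e > 0\<close>, where E' = E']) auto
    ultimately show "\<forall>\<^sub>F s in at_top. dist (E s) 0 < e"
      by eventually_elim auto
  qed
qed

text \<open>Let \<open>\<zeta> = x + \<i> y\<close> and \<open>A = \<zeta>' / x = a + \<i> b\<close>. The hypotheses on \<open>a'\<close> and \<open>b'\<close> say that
  \<open>A' = \<i> (q + b) A\<close> up to an error that tends to \<open>0\<close>, and \<open>\<bar>A\<bar>\<close>, the hyperbolic speed, tends to \<open>v\<close>. Near \<open>a = 0\<close> one has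
  \<open>\<bar>b\<bar> > \<bar>q\<bar>\<close>, so \<open>a\<close> decreases there at a definite rate. Therefore \<open>a\<close> is eventually either above some \<open>a1 > 0\<close> or below
  \<open>- a1\<close>. The second case is incompatible with an unbounded curve because \<open>x' = a x\<close>. In the first case
  \<open>b + q\<close> satisfies the unstable equation \<open>(b + q)' = a (b + q)\<close> and tends to \<open>0\<close>; this determines the limits of \<open>b\<close> and \<open>a\<close>,
  and l'Hospital's rule gives that of \<open>y / x\<close>.\<close>
lemma halfplane_curve_slope:
  fixes x y a b a' b' :: "real \<Rightarrow> real" and q v :: real
  assumes x_pos: "\<And>s. x s > 0"
    and dx: "\<And>s. (x has_real_derivative a s * x s) (at s)"
    and dy: "\<And>s. (y has_real_derivative b s * x s) (at s)"
    and da: "\<And>s. (a has_real_derivative a' s) (at s)"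
    and db: "\<And>s. (b has_real_derivative b' s) (at s)"
    and lim_a': "((\<lambda>s. a' s + b s * (b s + q)) \<longlongrightarrow> 0) at_top"
    and lim_b': "((\<lambda>s. b' s - a s * (b s + q)) \<longlongrightarrow> 0) at_top"
    and speed: "((\<lambda>s. (a s)\<^sup>2 + (b s)\<^sup>2) \<longlongrightarrow> v\<^sup>2) at_top"
    and q: "\<bar>q\<bar> < v"
    and unbounded: "filterlim (\<lambda>s. norm (Complex (x s) (y s))) at_top at_top"
  shows "filterlim x at_top at_top"
    and "((\<lambda>s. y s / x s) \<longlongrightarrow> - q / sqrt (v\<^sup>2 - q\<^sup>2)) at_top"
proof -
  define \<mu> where "\<mu> = (v + \<bar>q\<bar>) / 2"
  have \<mu>: "\<bar>q\<bar> < \<mu>" "\<mu> < v" "\<mu> > 0" using q by (auto simp: \<mu>_def)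
  have "\<mu>\<^sup>2 < v\<^sup>2" using \<mu> by (intro power_strict_mono) auto
  define a1 where "a1 = sqrt ((v\<^sup>2 - \<mu>\<^sup>2) / 2)"
  have a1: "a1 > 0" "a1\<^sup>2 = (v\<^sup>2 - \<mu>\<^sup>2) / 2" using \<open>\<mu>\<^sup>2 < v\<^sup>2\<close> by (auto simp: a1_def)
  define m where "m = \<mu> * (\<mu> - \<bar>q\<bar>) / 2"
  have "m > 0" using \<mu> by (auto simp: m_def)
  have "\<forall>\<^sub>F s in at_top. (a s)\<^sup>2 + (b s)\<^sup>2 > (v\<^sup>2 + \<mu>\<^sup>2) / 2"
    using \<open>\<mu>\<^sup>2 < v\<^sup>2\<close> by (intro order_tendstoD(1)[OF speed]) simp
  moreover have "\<forall>\<^sub>F s in at_top. (a s)\<^sup>2 + (b s)\<^sup>2 < v\<^sup>2 + 1"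
    by (intro order_tendstoD(2)[OF speed]) simp
  moreover have "\<forall>\<^sub>F s in at_top. a' s + b s * (b s + q) < m"
    using \<open>m > 0\<close> by (intro order_tendstoD(2)[OF lim_a']) simp
  ultimately have "\<forall>\<^sub>F s in at_top. (a s)\<^sup>2 + (b s)\<^sup>2 > (v\<^sup>2 + \<mu>\<^sup>2) / 2 \<and>
      (a s)\<^sup>2 + (b s)\<^sup>2 < v\<^sup>2 + 1 \<and> a' s + b s * (b s + q) < m"
    by eventually_elim simp
  then obtain s1 where s1: "\<And>s. s \<ge> s1 \<Longrightarrow> (a s)\<^sup>2 + (b s)\<^sup>2 > (v\<^sup>2 + \<mu>\<^sup>2) / 2 \<and>
      (a s)\<^sup>2 + (b s)\<^sup>2 < v\<^sup>2 + 1 \<and> a' s + b s * (b s + q) < m"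
    by (auto simp: eventually_at_top_linorder)
  define B where "B = sqrt (v\<^sup>2 + 1)"
  have b_bd: "\<bar>b s\<bar> \<le> B" if "s \<ge> s1" for s
  proof -
    have "(b s)\<^sup>2 \<le> v\<^sup>2 + 1" using s1[OF that] zero_le_power2[of "a s"] by linarith
    then show ?thesis by (simp add: B_def real_le_rsqrt)
  qed
  have turn: "a' s \<le> - m" if "s \<ge> s1" "\<bar>a s\<bar> \<le> a1" for s
  proof -
    have "(a s)\<^sup>2 \<le> a1\<^sup>2" using that a1 by (simp add: abs_le_square_iff[symmetric])
    with s1[OF that(1)] a1(2) have "\<mu>\<^sup>2 \<le> (b s)\<^sup>2" by argo
    then have "\<mu> \<le> \<bar>b s\<bar>" using \<mu> by (simp add: abs_le_square_iff[symmetric])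
    then have "\<mu> * (\<mu> - \<bar>q\<bar>) \<le> \<bar>b s\<bar> * (\<bar>b s\<bar> - \<bar>q\<bar>)"
      using \<mu> by (intro mult_mono) auto
    also have "\<dots> \<le> b s * (b s + q)"
      using abs_ge_minus_self[of "b s * q"] by (simp add: algebra_simps abs_mult flip: power2_eq_square)
    finally show ?thesis using s1[OF that(1)] by (simp add: m_def)
  qed
  have forward: "a s \<ge> a1" if "s \<ge> s1" for s
  proof (rule ccontr)
    assume "\<not> a s \<ge> a1"
    have "\<exists>s'\<ge>s. - a s' > a1"
    proof (rule uniform_drift_escapes[where f' = "\<lambda>s. - a' s" and m = m and L = "- a1"])
      show "m \<le> - a' u" if "u \<ge> s" "- a1 \<le> - a u" "- a u \<le> a1" for u
        using turn[of u] that \<open>s \<ge> s1\<close> by linarith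
    qed (use \<open>\<not> a s \<ge> a1\<close> a1(1) \<open>m > 0\<close> in \<open>auto intro!: derivative_eq_intros da\<close>)
    then obtain s2 where "s2 \<ge> s" "- a s2 > a1" by blast
    with \<open>s \<ge> s1\<close> have s2: "s2 \<ge> s1" "a s2 \<le> - a1" by linarith+
    have leftward: "a u \<le> - a1" if "u \<ge> s2" for u
    proof (rule barrier_above[where f = a and f' = a' and ?s0.0 = s2 and s = u])
      fix w assume "w \<ge> s2" "a w = - a1"
      with turn[of w] s2 a1 \<open>m > 0\<close> show "a' w < 0" by auto
    qed (use da s2 that in auto)
    \<comment> \<open>With this \<open>C\<close>, both \<open>y + C x\<close> and \<open>- y + C x\<close> are decreasing, because \<open>\<bar>y'\<bar> \<le> B x\<close> and \<open>x' \<le> - a1 x\<close>.\<close>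
    define C where "C = B / a1"
    have "C \<ge> 0" using a1 by (simp add: C_def B_def)
    have "x u \<le> x s2" if "u \<ge> s2" for u
    proof (rule DERIV_nonpos_imp_nonincreasing[OF that])
      fix w assume "s2 \<le> w" "w \<le> u"
      then show "\<exists>y. (x has_real_derivative y) (at w) \<and> y \<le> 0"
        using dx[of w] leftward[of w] x_pos[of w] a1(1)
        by (intro exI[of _ "a w * x w"]) (auto intro!: mult_nonpos_nonneg)
    qed
    moreover have "y u + C * x u \<le> y s2 + C * x s2" if "u \<ge> s2" for u
    proof (rule DERIV_nonpos_imp_nonincreasing[OF that])
      fix w assume w: "s2 \<le> w" "w \<le> u"
      have "C * a w \<le> C * - a1" using leftward[OF w(1)] \<open>C \<ge> 0\<close> by (intro mult_left_mono) auto
      also have "\<dots> = - B" using a1 by (simp add: C_def)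
      finally have "b w + C * a w \<le> 0" using b_bd[of w] w s2 by auto
      then have "(b w + C * a w) * x w \<le> 0" using x_pos[of w] by (intro mult_nonpos_nonneg) auto
      then show "\<exists>z. ((\<lambda>u. y u + C * x u) has_real_derivative z) (at w) \<and> z \<le> 0"
        by (intro exI[of _ "(b w + C * a w) * x w"]) (auto intro!: derivative_eq_intros dx dy simp: algebra_simps)
    qed
    moreover have "- y u + C * x u \<le> - y s2 + C * x s2" if "u \<ge> s2" for u
    proof (rule DERIV_nonpos_imp_nonincreasing[OF that])
      fix w assume w: "s2 \<le> w" "w \<le> u"
      have "C * a w \<le> C * - a1" using leftward[OF w(1)] \<open>C \<ge> 0\<close> by (intro mult_left_mono) auto
      also have "\<dots> = - B" using a1 by (simp add: C_def)
      finally have "- b w + C * a w \<le> 0" using b_bd[of w] w s2 by auto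
      then have "(- b w + C * a w) * x w \<le> 0" using x_pos[of w] by (intro mult_nonpos_nonneg) auto
      then show "\<exists>z. ((\<lambda>u. - y u + C * x u) has_real_derivative z) (at w) \<and> z \<le> 0"
        by (intro exI[of _ "(- b w + C * a w) * x w"]) (auto intro!: derivative_eq_intros dx dy simp: algebra_simps)
    qed
    ultimately have bounded: "norm (Complex (x u) (y u)) \<le> x s2 + (\<bar>y s2\<bar> + C * x s2)" if "u \<ge> s2" for u
    proof -
      have "norm (Complex (x u) (y u)) \<le> \<bar>x u\<bar> + \<bar>y u\<bar>" using cmod_le[of "Complex (x u) (y u)"] by simp
      moreover have "C * x u \<ge> 0" using x_pos[of u] \<open>C \<ge> 0\<close> by simp
      ultimately show ?thesis
        using \<open>\<And>u. u \<ge> s2 \<Longrightarrow> x u \<le> x s2\<close>[OF that] x_pos[of u]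
          \<open>\<And>u. u \<ge> s2 \<Longrightarrow> y u + C * x u \<le> y s2 + C * x s2\<close>[OF that]
          \<open>\<And>u. u \<ge> s2 \<Longrightarrow> - y u + C * x u \<le> - y s2 + C * x s2\<close>[OF that] by argo
    qed
    have "\<forall>\<^sub>F u in at_top. norm (Complex (x u) (y u)) > x s2 + (\<bar>y s2\<bar> + C * x s2)"
      using unbounded unfolding filterlim_at_top_dense by blast
    then have "\<forall>\<^sub>F u::real in at_top. False"
      using eventually_ge_at_top[of s2]
    proof eventually_elim
      case (elim u)
      then show False using bounded[of u] by linarith
    qed
    then show False by simp
  qed
  have bq_lim: "((\<lambda>s. b s + q) \<longlongrightarrow> 0) at_top"
  proof (rule unstable_bounded_tendsto_0[where E' = b' and a = a and ?a1.0 = a1 and B = "B + \<bar>q\<bar>"])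
    show "\<bar>b s + q\<bar> \<le> B + \<bar>q\<bar>" if "s \<ge> s1" for s
      using b_bd[OF that] abs_triangle_ineq[of "b s" q] by linarith
  qed (use a1 lim_b' forward in \<open>auto intro!: derivative_eq_intros db simp: eventually_at_top_linorder\<close>)
  have b_lim: "(b \<longlongrightarrow> - q) at_top"
    using tendsto_diff[OF bq_lim tendsto_const[of q]] by simp
  have "((\<lambda>s. sqrt (((a s)\<^sup>2 + (b s)\<^sup>2) - (b s)\<^sup>2)) \<longlongrightarrow> sqrt (v\<^sup>2 - (- q)\<^sup>2)) at_top"
    by (intro tendsto_intros speed b_lim)
  moreover have "\<forall>\<^sub>F s in at_top. sqrt (((a s)\<^sup>2 + (b s)\<^sup>2) - (b s)\<^sup>2) = a s"
    using eventually_ge_at_top[of s1]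
  proof eventually_elim
    case (elim s)
    then show ?case using forward[of s] a1(1) by simp
  qed
  ultimately have a_lim: "(a \<longlongrightarrow> sqrt (v\<^sup>2 - q\<^sup>2)) at_top"
    using tendsto_cong by force
  show x_top: "filterlim x at_top at_top"
  proof -
    have grow: "\<exists>s\<ge>s1. x s > Z" for Z
    proof (rule uniform_drift_escapes[where f' = "\<lambda>s. a s * x s" and m = "a1 * x s1" and U = "max Z (x s1)" and L = "x s1", THEN ex_forward])
      show "a s * x s \<ge> a1 * x s1" if "s \<ge> s1" "x s1 \<le> x s" for s
        using forward[OF that(1)] that x_pos[of s1] a1 by (intro mult_mono) auto
    qed (use dx a1 x_pos in auto)
    have mono: "x s \<le> x u" if "s1 \<le> s" "s \<le> u" for s u
    proof (rule DERIV_nonneg_imp_nondecreasing[OF that(2)])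
      fix w assume "s \<le> w" "w \<le> u"
      then show "\<exists>y. (x has_real_derivative y) (at w) \<and> 0 \<le> y"
        using dx[of w] forward[of w] x_pos[of w] a1(1) that
        by (intro exI[of _ "a w * x w"]) (auto intro!: mult_nonneg_nonneg)
    qed
    show ?thesis
      unfolding filterlim_at_top eventually_at_top_linorder
    proof
      fix Z obtain s where "s \<ge> s1" "x s > Z" using grow by blast
      then show "\<exists>N. \<forall>n\<ge>N. Z \<le> x n" using mono[of s] by (intro exI[of _ s]) (auto intro: order_trans[of _ "x s"])
    qed
  qed
  show "((\<lambda>s. y s / x s) \<longlongrightarrow> - q / sqrt (v\<^sup>2 - q\<^sup>2)) at_top"
  proof (rule lhospital_at_top_at_top[where f' = "\<lambda>s. b s * x s" and g' = "\<lambda>s. a s * x s"])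
    have "q\<^sup>2 < v\<^sup>2" using q by (intro power2_strict_mono) auto
    then have "((\<lambda>s. b s / a s) \<longlongrightarrow> - q / sqrt (v\<^sup>2 - q\<^sup>2)) at_top"
      by (intro tendsto_intros a_lim b_lim) auto
    then show "((\<lambda>s. b s * x s / (a s * x s)) \<longlongrightarrow> - q / sqrt (v\<^sup>2 - q\<^sup>2)) at_top"
      using x_pos by (simp add: less_imp_neq[symmetric])
    show "\<forall>\<^sub>F s in at_top. a s * x s \<noteq> 0"
      using eventually_ge_at_top[of s1]
    proof eventually_elim
      case (elim s)
      then show ?case using forward[of s] a1(1) x_pos[of s] by simp
    qed
  qed (use x_top dx dy in auto)
qed

section \<open>The slope of a vertical ray under the Riemann map\<close>

lemma tendsto_at_top_by_subsequences:
  fixes \<Phi> :: "real \<Rightarrow> 'a :: metric_space"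
  assumes "\<And>t :: nat \<Rightarrow> real. filterlim t at_top sequentially \<Longrightarrow>
             \<exists>r. strict_mono (r :: nat \<Rightarrow> nat) \<and> (\<lambda>n. \<Phi> (t (r n))) \<longlonglongrightarrow> l"
  shows "(\<Phi> \<longlongrightarrow> l) at_top"
proof (rule tendstoI, rule ccontr)
  fix e :: real assume "e > 0" and "\<not> (\<forall>\<^sub>F t in at_top. dist (\<Phi> t) l < e)"
  then have "\<exists>t\<ge>real n. dist (\<Phi> t) l \<ge> e" for n
    unfolding eventually_at_top_linorder by (metis not_less)
  then obtain t where t: "\<And>n. t n \<ge> real n" "\<And>n. dist (\<Phi> (t n)) l \<ge> e" by metis
  have "filterlim t at_top sequentially"
    by (rule filterlim_at_top_mono[OF filterlim_real_sequentially]) (use t in auto)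
  then obtain r where r: "(\<lambda>n. \<Phi> (t (r n))) \<longlonglongrightarrow> l" using assms by blast
  have "\<forall>\<^sub>F n in sequentially. dist (\<Phi> (t (r n))) l < e" using tendstoD[OF r \<open>e > 0\<close>] .
  then show False using t(2) by (auto simp: eventually_sequentially not_less[symmetric])
qed

text \<open>
  A domain starlike at infinity with its conformal map \<open>\<psi>\<close> onto the half-plane and the inverse \<open>F\<close>, a point \<open>w0\<close>
  outside it, the starting point \<open>c\<close> of a vertical ray inside it, and a possibly different point \<open>p\<close> with
  respect to which the angular extents converge to positive limits.\<close>
locale koenigs_domain =
  fixes \<Omega> :: "complex set" and \<psi> F :: "complex \<Rightarrow> complex" and c p w0 :: complex and a b :: real
  assumes open_\<Omega>: "open \<Omega>" and up: "\<And>w t. w \<in> \<Omega> \<Longrightarrow> t \<ge> 0 \<Longrightarrow> w + \<i> * complex_of_real t \<in> \<Omega>"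
    and w0: "w0 \<notin> \<Omega>" and c: "c \<in> \<Omega>"
    and \<psi>_hol: "\<psi> holomorphic_on \<Omega>" and \<psi>_pos: "\<And>w. w \<in> \<Omega> \<Longrightarrow> Re (\<psi> w) > 0"
    and F_hol: "F holomorphic_on {z. Re z > 0}" and F_\<Omega>: "\<And>z. Re z > 0 \<Longrightarrow> F z \<in> \<Omega>"
    and F\<psi>: "\<And>w. w \<in> \<Omega> \<Longrightarrow> F (\<psi> w) = w"
    and p: "\<forall>\<^sub>F t in at_top. p + \<i> * complex_of_real t \<in> \<Omega>"
    and left: "(left_angular_extent \<Omega> p \<longlongrightarrow> a) at_top"
    and right: "(right_angular_extent \<Omega> p \<longlongrightarrow> b) at_top"
    and ab: "a > 0" "b > 0"
begin

text \<open>The map \<open>\<psi>\<close> in logarithmic coordinates; on the real axis it runs through the image of the vertical ray above \<open>c\<close>.\<close>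
definition \<Psi> :: "complex \<Rightarrow> complex" where
  "\<Psi> W = \<psi> (c + \<i> * exp W)"

definition log_domain :: "complex set" where
  "log_domain = {W. c + \<i> * exp W \<in> \<Omega>}"

lemma open_log_domain: "open log_domain"
proof -
  have "open ((\<lambda>W. c + \<i> * exp W) -` \<Omega>)"
    using open_\<Omega> by (intro open_vimage) (auto intro!: continuous_intros)
  then show ?thesis by (simp add: log_domain_def vimage_def)
qed

lemma real_in_log_domain: "complex_of_real s \<in> log_domain"
  using up[OF c, of "exp s"] by (simp add: log_domain_def exp_of_real)

lemma \<Psi>_hol: "\<Psi> holomorphic_on log_domain"
  unfolding \<Psi>_def
  by (rule holomorphic_on_compose_gen[OF _ \<psi>_hol, unfolded o_def])
     (auto simp: log_domain_def intro!: holomorphic_intros)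

lemma \<Psi>_pos: "W \<in> log_domain \<Longrightarrow> Re (\<Psi> W) > 0"
  by (simp add: \<Psi>_def log_domain_def \<psi>_pos)

lemma le_pi: "a \<le> pi" "b \<le> pi"
  by (rule tendsto_upperbound[OF left]; simp add: left_angular_extent_eq initial_extent_le_pi)
     (rule tendsto_upperbound[OF right]; simp add: right_angular_extent_eq initial_extent_le_pi)

text \<open>The dilations of the domain by factors tending to infinity, turned by \<open>- pi / 2\<close> so that the vertical direction
  becomes the positive real one, converge to the sector.\<close>
lemma dilations:
  assumes s: "filterlim s at_top sequentially"
  shows "dilated_domains a b (strip_to_disk a b) (disk_to_strip a b)
    (\<lambda>n. {v. c + \<i> * of_real (exp (s n)) * v \<in> \<Omega>})
    (\<lambda>n v. hp_to_disk (\<Psi> (of_real (s n))) (\<psi> (c + \<i> * of_real (exp (s n)) * v)))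
    (\<lambda>n u. (F (disk_to_hp (\<Psi> (of_real (s n))) u) - c) / (\<i> * of_real (exp (s n))))
    (\<lambda>n. (w0 - c) / (\<i> * of_real (exp (s n))))"
proof
  have \<zeta>: "Re (\<Psi> (of_real (s n))) > 0" for n by (rule \<Psi>_pos[OF real_in_log_domain])
  have scale: "c + \<i> * of_real (exp (s n)) * ((w - c) / (\<i> * of_real (exp (s n)))) = w" for n w by simp
  show "0 < a" "a \<le> pi" "0 < b" "b \<le> pi" using ab le_pi by auto
  show "strip_to_disk a b holomorphic_on strip a b" using ab by (rule strip_to_disk_holomorphic)
  show "norm (strip_to_disk a b W) < 1" if "W \<in> strip a b" for W using ab that by (rule norm_strip_to_disk)
  show "disk_to_strip a b holomorphic_on ball 0 1" using ab by (rule disk_to_strip_holomorphic)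
  show "disk_to_strip a b u \<in> strip a b" if "norm u < 1" for u using ab that by (rule disk_to_strip_in_strip)
  show "strip_to_disk a b (disk_to_strip a b u) = u" if "norm u < 1" for u using ab that by (rule strip_to_disk_to_strip)
  show "disk_to_strip a b (strip_to_disk a b W) = W" if "W \<in> strip a b" for W using ab that by (rule disk_to_strip_to_disk)
  show "strip_to_disk a b 0 = 0" using ab by (rule strip_to_disk_0)
  fix n
  show "(\<lambda>v. hp_to_disk (\<Psi> (of_real (s n))) (\<psi> (c + \<i> * of_real (exp (s n)) * v)))
      holomorphic_on {v. c + \<i> * of_real (exp (s n)) * v \<in> \<Omega>}"
  proof (intro holomorphic_on_hp_to_disk \<zeta>)
    show "(\<lambda>v. \<psi> (c + \<i> * of_real (exp (s n)) * v)) holomorphic_on {v. c + \<i> * of_real (exp (s n)) * v \<in> \<Omega>}"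
      by (rule holomorphic_on_compose_gen[OF _ \<psi>_hol, unfolded o_def]) (auto intro!: holomorphic_intros)
  qed (auto simp: \<psi>_pos)
  show "norm (hp_to_disk (\<Psi> (of_real (s n))) (\<psi> (c + \<i> * of_real (exp (s n)) * v))) < 1"
    if "v \<in> {v. c + \<i> * of_real (exp (s n)) * v \<in> \<Omega>}" for v
    using that \<psi>_pos by (intro norm_hp_to_disk \<zeta>) auto
  have pos: "Re (disk_to_hp (\<Psi> (of_real (s n))) u) > 0" if "norm u < 1" for u
    using \<zeta> that by (rule Re_disk_to_hp)
  have "(\<lambda>u. F (disk_to_hp (\<Psi> (of_real (s n))) u)) holomorphic_on ball 0 1"
    using pos by (intro holomorphic_on_compose_gen[OF _ F_hol, unfolded o_def] holomorphic_on_disk_to_hp)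
      (auto intro!: holomorphic_intros)
  then show "(\<lambda>u. (F (disk_to_hp (\<Psi> (of_real (s n))) u) - c) / (\<i> * of_real (exp (s n)))) holomorphic_on ball 0 1"
    by (intro holomorphic_intros) auto
  show "(F (disk_to_hp (\<Psi> (of_real (s n))) u) - c) / (\<i> * of_real (exp (s n))) \<in> {v. c + \<i> * of_real (exp (s n)) * v \<in> \<Omega>}"
    if "norm u < 1" for u
    using F_\<Omega>[OF pos[OF that]] by (simp only: scale mem_Collect_eq)
  show "(F (disk_to_hp (\<Psi> (of_real (s n))) (hp_to_disk (\<Psi> (of_real (s n))) (\<psi> (c + \<i> * of_real (exp (s n)) * v)))) - c) /
      (\<i> * of_real (exp (s n))) = v" if "v \<in> {v. c + \<i> * of_real (exp (s n)) * v \<in> \<Omega>}" for v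
    using that by (simp add: disk_to_hp_to_disk[OF \<zeta>] \<psi>_pos F\<psi>)
  show "1 \<in> {v. c + \<i> * of_real (exp (s n)) * v \<in> \<Omega>}" using up[OF c] by simp
  show "hp_to_disk (\<Psi> (of_real (s n))) (\<psi> (c + \<i> * of_real (exp (s n)) * 1)) = 0"
    by (simp add: \<Psi>_def exp_of_real)
  show "v + of_real r \<in> {v. c + \<i> * of_real (exp (s n)) * v \<in> \<Omega>}"
    if "v \<in> {v. c + \<i> * of_real (exp (s n)) * v \<in> \<Omega>}" "r \<ge> 0" for v r
    using up[of "c + \<i> * of_real (exp (s n)) * v" "exp (s n) * r"] that by (simp add: algebra_simps)
  show "(w0 - c) / (\<i> * of_real (exp (s n))) \<notin> {v. c + \<i> * of_real (exp (s n)) * v \<in> \<Omega>}"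
    using w0 by (simp only: scale mem_Collect_eq not_False_eq_True)
next
  have t: "filterlim (\<lambda>n. exp (s n)) at_top sequentially"
    by (rule filterlim_compose[OF exp_at_top s])
  show "\<forall>\<^sub>F n in sequentially. exp ` K \<subseteq> {v. c + \<i> * of_real (exp (s n)) * v \<in> \<Omega>}"
    if "compact K" "K \<subseteq> strip a b" for K
    using eventually_compose_filterlim[OF compact_subset_of_strip_eventually_inside[OF left right that] t]
    by eventually_elim auto
  show "(\<lambda>n. (w0 - c) / (\<i> * of_real (exp (s n)))) \<longlonglongrightarrow> 0"
  proof (rule tendsto_divide_0[OF tendsto_const])
    show "filterlim (\<lambda>n. \<i> * complex_of_real (exp (s n))) at_infinity sequentially"
      by (rule filterlim_compose[OF _ t, of "\<lambda>t. \<i> * complex_of_real t"])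
         (intro tendsto_mult_filterlim_at_infinity[OF tendsto_const] filterlim_of_real_at_infinity, auto)
  qed
  note ray = ray_limit_of_omitted_points[OF open_\<Omega> up w0 p]
  fix x
  obtain \<beta> where "\<forall>\<^sub>F t in at_top. c + \<i> * of_real t * \<beta> t \<notin> \<Omega>" "(\<beta> \<longlongrightarrow> exp (Complex x (1 * a))) at_top"
    using ray[of 1 a c x] left unfolding left_angular_extent_eq[abs_def] by auto
  then show "\<exists>\<beta>. (\<forall>\<^sub>F n in sequentially. \<beta> n \<notin> {v. c + \<i> * of_real (exp (s n)) * v \<in> \<Omega>}) \<and> \<beta> \<longlonglongrightarrow> exp (Complex x a)"
    using eventually_compose_filterlim[OF _ t] filterlim_compose[OF _ t]
    by (intro exI[of _ "\<lambda>n. \<beta> (exp (s n))"]) auto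
  obtain \<beta> where "\<forall>\<^sub>F t in at_top. c + \<i> * of_real t * \<beta> t \<notin> \<Omega>" "(\<beta> \<longlongrightarrow> exp (Complex x ((-1) * b))) at_top"
    using ray[of "-1" b c x] right unfolding right_angular_extent_eq[abs_def] by auto
  then show "\<exists>\<beta>. (\<forall>\<^sub>F n in sequentially. \<beta> n \<notin> {v. c + \<i> * of_real (exp (s n)) * v \<in> \<Omega>}) \<and> \<beta> \<longlonglongrightarrow> exp (Complex x (- b))"
    using eventually_compose_filterlim[OF _ t] filterlim_compose[OF _ t]
    by (intro exI[of _ "\<lambda>n. \<beta> (exp (s n))"]) auto
qed

lemma log_time_derivs:
  fixes s :: real
  defines "Y \<equiv> \<lambda>W. hp_to_disk (\<Psi> (of_real s)) (\<psi> (c + \<i> * of_real (exp s) * exp W))"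
    and "x \<equiv> complex_of_real (Re (\<Psi> (of_real s)))"
  shows "deriv Y 0 = deriv \<Psi> (of_real s) / (2 * x)"
    and "deriv (deriv Y) 0 = deriv (deriv \<Psi>) (of_real s) / (2 * x) - (deriv \<Psi> (of_real s))\<^sup>2 / (2 * x\<^sup>2)"
proof -
  define Z where "Z = (\<lambda>W. hp_to_disk (\<Psi> (of_real s)) (\<Psi> W))"
  have "Y = Z \<circ> (\<lambda>W. of_real s + W)"
    by (simp add: Y_def Z_def \<Psi>_def o_def exp_add exp_of_real mult.assoc)
  then have shift: "(deriv ^^ m) Y 0 = (deriv ^^ m) Z (of_real s)" for m
    using higher_deriv_shift_0[of m Z "of_real s"] by simp
  note D = deriv_hp_to_disk[OF \<Psi>_hol open_log_domain real_in_log_domain[of s] \<Psi>_pos, folded Z_def x_def]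
  show "deriv Y 0 = deriv \<Psi> (of_real s) / (2 * x)" using shift[of 1] D(1) by simp
  show "deriv (deriv Y) 0 = deriv (deriv \<Psi>) (of_real s) / (2 * x) - (deriv \<Psi> (of_real s))\<^sup>2 / (2 * x\<^sup>2)"
    using shift[of 2] D(2) by (simp add: numeral_2_eq_2)
qed

text \<open>The kernel theorem provides the limits along subsequences of every sequence of times, and they do not depend on the
  sequence.\<close>
lemma log_time_invariants:
  defines "A \<equiv> \<lambda>s. deriv \<Psi> (complex_of_real s) / of_real (Re (\<Psi> (of_real s)))"
  shows "((\<lambda>s. norm (A s)) \<longlongrightarrow> strip_exponent a b / cos (strip_angle a b)) at_top"
    and "((\<lambda>s. deriv (deriv \<Psi>) (of_real s) / deriv \<Psi> (of_real s) - A s)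
           \<longlongrightarrow> - \<i> * of_real (strip_exponent a b * tan (strip_angle a b))) at_top"
proof -
  have pos: "Re (\<Psi> (of_real s)) > 0" for s by (rule \<Psi>_pos[OF real_in_log_domain])
  \<comment> \<open>The case distinction supplies the value that the quotient of derivatives has by the convention \<open>x / 0 = 0\<close>.\<close>
  have both: "\<exists>r. strict_mono (r :: nat \<Rightarrow> nat) \<and>
      (\<lambda>n. norm (A (s (r n)))) \<longlonglongrightarrow> strip_exponent a b / cos (strip_angle a b) \<and>
      (\<lambda>n. if A (s (r n)) = 0 then 0 else deriv (deriv \<Psi>) (of_real (s (r n))) / deriv \<Psi> (of_real (s (r n))) - A (s (r n)))
           \<longlonglongrightarrow> - \<i> * of_real (strip_exponent a b * tan (strip_angle a b))"
    if "filterlim s at_top sequentially" for s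
  proof -
    interpret D: dilated_domains a b "strip_to_disk a b" "disk_to_strip a b"
      "\<lambda>n. {v. c + \<i> * of_real (exp (s n)) * v \<in> \<Omega>}"
      "\<lambda>n v. hp_to_disk (\<Psi> (of_real (s n))) (\<psi> (c + \<i> * of_real (exp (s n)) * v))"
      "\<lambda>n u. (F (disk_to_hp (\<Psi> (of_real (s n))) u) - c) / (\<i> * of_real (exp (s n)))"
      "\<lambda>n. (w0 - c) / (\<i> * of_real (exp (s n)))"
      using dilations[OF that] .
    obtain r where r: "strict_mono (r :: nat \<Rightarrow> nat)"
      and lim: "(\<lambda>n. norm (deriv \<Psi> (of_real (s (r n))) / (2 * of_real (Re (\<Psi> (of_real (s (r n)))))))) \<longlonglongrightarrow>
         strip_exponent a b / (2 * cos (strip_angle a b))"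
       "(\<lambda>n. (deriv (deriv \<Psi>) (of_real (s (r n))) / (2 * of_real (Re (\<Psi> (of_real (s (r n))))))
            - (deriv \<Psi> (of_real (s (r n))))\<^sup>2 / (2 * (of_real (Re (\<Psi> (of_real (s (r n))))))\<^sup>2))
          / (deriv \<Psi> (of_real (s (r n))) / (2 * of_real (Re (\<Psi> (of_real (s (r n)))))))) \<longlonglongrightarrow>
         - \<i> * of_real (strip_exponent a b * tan (strip_angle a b))"
      by (rule D.subsequence_invariants[unfolded log_time_derivs strip_to_disk_invariants[OF ab]])
    have "(\<lambda>n. norm (A (s (r n)))) \<longlonglongrightarrow> strip_exponent a b / cos (strip_angle a b)"
      using tendsto_mult_left[OF lim(1), of 2] by (simp add: A_def norm_divide norm_mult)
    moreover have "(deriv (deriv \<Psi>) (of_real u) / (2 * of_real (Re (\<Psi> (of_real u))))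
            - (deriv \<Psi> (of_real u))\<^sup>2 / (2 * (of_real (Re (\<Psi> (of_real u))))\<^sup>2))
          / (deriv \<Psi> (of_real u) / (2 * of_real (Re (\<Psi> (of_real u)))))
        = (if A u = 0 then 0 else deriv (deriv \<Psi>) (of_real u) / deriv \<Psi> (of_real u) - A u)" for u :: real
      using pos[of u] by (auto simp: A_def field_simps power2_eq_square)
    ultimately show ?thesis using r lim(2) by auto
  qed
  show lim1: "((\<lambda>s. norm (A s)) \<longlongrightarrow> strip_exponent a b / cos (strip_angle a b)) at_top"
    by (rule tendsto_at_top_by_subsequences) (use both in blast)
  have lim2: "((\<lambda>s. if A s = 0 then 0 else deriv (deriv \<Psi>) (of_real s) / deriv \<Psi> (of_real s) - A s)
           \<longlongrightarrow> - \<i> * of_real (strip_exponent a b * tan (strip_angle a b))) at_top"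
    by (rule tendsto_at_top_by_subsequences) (use both in blast)
  have "strip_exponent a b / cos (strip_angle a b) > 0"
    using strip_exponent_pos[OF ab] cos_strip_angle_pos[OF ab] by simp
  then have "\<forall>\<^sub>F s in at_top. norm (A s) > 0" by (rule order_tendstoD(1)[OF lim1])
  then have "\<forall>\<^sub>F s in at_top. (if A s = 0 then 0 else deriv (deriv \<Psi>) (of_real s) / deriv \<Psi> (of_real s) - A s)
      = deriv (deriv \<Psi>) (of_real s) / deriv \<Psi> (of_real s) - A s"
    by eventually_elim auto
  then show "((\<lambda>s. deriv (deriv \<Psi>) (of_real s) / deriv \<Psi> (of_real s) - A s)
           \<longlongrightarrow> - \<i> * of_real (strip_exponent a b * tan (strip_angle a b))) at_top"
    using lim2 by (simp add: tendsto_cong)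
qed

end

text \<open>
  With \<open>A = \<Psi>' / Re \<Psi>\<close> and \<open>Q = \<Psi>'' / \<Psi>' - A\<close> one computes \<open>A' = A (Q + \<i> Im A)\<close>. Since \<open>Q\<close> tends to \<open>\<i> q\<close>, this is the
  differential equation required by the lemma on curves, with \<open>q = - v sin \<omega>\<close> and \<open>v = k / cos \<omega>\<close>.\<close>
lemma (in koenigs_domain) vertical_ray_slope:
  assumes unbounded: "filterlim (\<lambda>t. norm (\<psi> (c + \<i> * of_real t))) at_top at_top"
  shows "filterlim (\<lambda>t. Re (\<psi> (c + \<i> * of_real t))) at_top at_top"
    and "((\<lambda>t. Im (\<psi> (c + \<i> * of_real t)) / Re (\<psi> (c + \<i> * of_real t))) \<longlongrightarrow> tan (strip_angle a b)) at_top"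
proof -
  define k \<omega> where "k = strip_exponent a b" and "\<omega> = strip_angle a b"
  have k: "k > 0" and cos: "cos \<omega> > 0"
    using strip_exponent_pos[OF ab] cos_strip_angle_pos[OF ab] by (simp_all add: k_def \<omega>_def)
  define v q where "v = k / cos \<omega>" and "q = - (k * tan \<omega>)"
  have "v > 0" using k cos by (simp add: v_def)
  have q_eq: "q = - (v * sin \<omega>)" by (simp add: q_def v_def tan_def)
  have "(cos \<omega>)\<^sup>2 > 0" using cos by simp
  then have "(sin \<omega>)\<^sup>2 < 1" using sin_cos_squared_add[of \<omega>] by linarith
  then have "\<bar>sin \<omega>\<bar> < 1" by (simp add: abs_square_less_1)
  then have qv: "\<bar>q\<bar> < v" using \<open>v > 0\<close> by (simp add: q_eq abs_mult)
  have "v\<^sup>2 - q\<^sup>2 = v\<^sup>2 * (1 - (sin \<omega>)\<^sup>2)"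
    by (simp add: q_eq power_mult_distrib right_diff_distrib)
  also have "\<dots> = k\<^sup>2" using cos by (simp add: v_def power_divide flip: cos_squared_eq)
  finally have slope: "- q / sqrt (v\<^sup>2 - q\<^sup>2) = tan \<omega>" using k by (simp add: q_def)
  define x y where "x = (\<lambda>s. Re (\<Psi> (of_real s)))" and "y = (\<lambda>s. Im (\<Psi> (of_real s)))"
  define A where "A = (\<lambda>s. deriv \<Psi> (of_real s) / of_real (x s))"
  define A' where "A' = (\<lambda>s. deriv (deriv \<Psi>) (of_real s) / of_real (x s) - A s * of_real (Re (A s)))"
  have x_pos: "x s > 0" for s unfolding x_def by (rule \<Psi>_pos[OF real_in_log_domain])
  have d1: "((\<lambda>s. \<Psi> (of_real s)) has_vector_derivative deriv \<Psi> (of_real s)) (at s)" for s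
    by (intro has_vector_derivative_real_field holomorphic_derivI[OF \<Psi>_hol open_log_domain real_in_log_domain])
  have d2: "((\<lambda>s. deriv \<Psi> (of_real s)) has_vector_derivative deriv (deriv \<Psi>) (of_real s)) (at s)" for s
    by (intro has_vector_derivative_real_field
          holomorphic_derivI[OF holomorphic_deriv[OF \<Psi>_hol open_log_domain] open_log_domain real_in_log_domain])
  have dx: "(x has_real_derivative Re (A s) * x s) (at s)" for s
    using has_field_derivative_Re[OF d1[of s]] x_pos[of s] by (simp add: x_def[symmetric] A_def Re_divide_of_real)
  have dy: "(y has_real_derivative Im (A s) * x s) (at s)" for s
    using has_field_derivative_Im[OF d1[of s]] x_pos[of s] by (simp add: y_def[symmetric] A_def Im_divide_of_real)
  have dA: "((\<lambda>s. Re (A s)) has_real_derivative Re (A' s)) (at s)"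
    "((\<lambda>s. Im (A s)) has_real_derivative Im (A' s)) (at s)" for s
    unfolding A_def A'_def Re_divide_of_real Im_divide_of_real
    using x_pos[of s]
    by (auto intro!: derivative_eq_intros d2 dx
        simp: A_def Re_divide_of_real Im_divide_of_real field_simps)
  have lim_v: "((\<lambda>s. norm (A s)) \<longlongrightarrow> v) at_top"
    using log_time_invariants(1) by (simp add: A_def x_def v_def k_def \<omega>_def)
  have lim_q: "((\<lambda>s. deriv (deriv \<Psi>) (of_real s) / deriv \<Psi> (of_real s) - A s) \<longlongrightarrow> \<i> * of_real q) at_top"
    using log_time_invariants(2) by (simp add: A_def x_def q_def k_def \<omega>_def)
  have "((\<lambda>s. norm (deriv (deriv \<Psi>) (of_real s) / deriv \<Psi> (of_real s) - A s - \<i> * of_real q) * norm (A s)) \<longlongrightarrow> 0 * v) at_top"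
    using lim_q by (intro tendsto_mult lim_v tendsto_norm_zero LIM_zero)
  then have "((\<lambda>s. norm ((deriv (deriv \<Psi>) (of_real s) / deriv \<Psi> (of_real s) - A s - \<i> * of_real q) * A s)) \<longlongrightarrow> 0) at_top"
    by (simp add: norm_mult)
  then have "((\<lambda>s. (deriv (deriv \<Psi>) (of_real s) / deriv \<Psi> (of_real s) - A s - \<i> * of_real q) * A s) \<longlongrightarrow> 0) at_top"
    by (rule tendsto_norm_zero_cancel)
  moreover have "\<forall>\<^sub>F s in at_top. (deriv (deriv \<Psi>) (of_real s) / deriv \<Psi> (of_real s) - A s - \<i> * of_real q) * A s
      = A' s - \<i> * of_real (Im (A s) + q) * A s"
    using order_tendstoD(1)[OF lim_v \<open>v > 0\<close>]
  proof eventually_elim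
    case (elim s)
    then have nz: "deriv \<Psi> (of_real s) \<noteq> 0" by (auto simp: A_def)
    have "deriv (deriv \<Psi>) (of_real s) / deriv \<Psi> (of_real s) * A s = deriv (deriv \<Psi>) (of_real s) / of_real (x s)"
      using nz by (simp add: A_def)
    then have "A' s = (deriv (deriv \<Psi>) (of_real s) / deriv \<Psi> (of_real s) - of_real (Re (A s))) * A s"
      by (simp add: A'_def algebra_simps)
    also have "of_real (Re (A s)) = A s - \<i> * of_real (Im (A s))" by (simp add: complex_eq_iff)
    finally show ?case by (simp add: algebra_simps)
  qed
  ultimately have rel: "((\<lambda>s. A' s - \<i> * of_real (Im (A s) + q) * A s) \<longlongrightarrow> 0) at_top"
    using tendsto_cong by force
  have "filterlim (\<lambda>s. norm (\<psi> (c + \<i> * of_real (exp s)))) at_top at_top"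
    by (rule filterlim_compose[OF unbounded exp_at_top])
  then have unb: "filterlim (\<lambda>s. norm (Complex (x s) (y s))) at_top at_top"
    by (simp add: x_def y_def \<Psi>_def exp_of_real)
  have main: "filterlim x at_top at_top" "((\<lambda>s. y s / x s) \<longlongrightarrow> tan \<omega>) at_top"
  proof -
    have a: "((\<lambda>s. Re (A' s) + Im (A s) * (Im (A s) + q)) \<longlongrightarrow> 0) at_top"
      using tendsto_Re[OF rel] by (simp add: algebra_simps)
    have b: "((\<lambda>s. Im (A' s) - Re (A s) * (Im (A s) + q)) \<longlongrightarrow> 0) at_top"
      using tendsto_Im[OF rel] by (simp add: algebra_simps)
    have sp: "((\<lambda>s. (Re (A s))\<^sup>2 + (Im (A s))\<^sup>2) \<longlongrightarrow> v\<^sup>2) at_top"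
      using tendsto_power[OF lim_v, of 2] by (simp add: cmod_power2)
    note H = halfplane_curve_slope[OF x_pos dx dy dA a b sp qv unb]
    show "filterlim x at_top at_top" by (rule H)
    show "((\<lambda>s. y s / x s) \<longlongrightarrow> tan \<omega>) at_top" using H(2) by (simp only: slope)
  qed
  have back_to_t: "\<forall>\<^sub>F t in at_top. \<Psi> (of_real (ln t)) = \<psi> (c + \<i> * of_real t)"
    using eventually_gt_at_top[of 0] by eventually_elim (simp add: \<Psi>_def exp_of_real)
  have "filterlim (\<lambda>t. Re (\<Psi> (of_real (ln t)))) at_top at_top"
    using filterlim_compose[OF main(1) ln_at_top] by (simp add: x_def)
  then show "filterlim (\<lambda>t. Re (\<psi> (c + \<i> * of_real t))) at_top at_top"
    by (rule filterlim_mono_eventually) (use back_to_t in \<open>auto elim: eventually_mono\<close>)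
  have "((\<lambda>t. Im (\<Psi> (of_real (ln t))) / Re (\<Psi> (of_real (ln t)))) \<longlongrightarrow> tan \<omega>) at_top"
    using filterlim_compose[OF main(2) ln_at_top] by (simp add: x_def y_def)
  then show "((\<lambda>t. Im (\<psi> (c + \<i> * of_real t)) / Re (\<psi> (c + \<i> * of_real t))) \<longlongrightarrow> tan (strip_angle a b)) at_top"
    unfolding \<omega>_def by (rule Lim_transform_eventually) (use back_to_t in \<open>auto elim: eventually_mono\<close>)
qed

lemma Arg_one_minus_disk:
  assumes "norm u < 1"
  shows "Arg (1 - u) = arctan (- Im (disk_to_hp 1 u) / (Re (disk_to_hp 1 u) + 1))"
proof -
  define \<zeta> where "\<zeta> = disk_to_hp 1 u"
  have "Re \<zeta> > 0" using Re_disk_to_hp[of 1 u] assms by (simp add: \<zeta>_def)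
  have "1 - u \<noteq> 0" using assms by auto
  then have "\<zeta> + 1 = 2 / (1 - u)" by (simp add: \<zeta>_def disk_to_hp_def field_simps)
  then have eq: "1 - u = 2 / (\<zeta> + 1)" by simp
  define d where "d = (Re \<zeta> + 1)\<^sup>2 + (Im \<zeta>)\<^sup>2"
  have "d > 0" using \<open>Re \<zeta> > 0\<close> by (simp add: d_def add_pos_nonneg)
  have parts: "Re (1 - u) = 2 * (Re \<zeta> + 1) / d" "Im (1 - u) = - 2 * Im \<zeta> / d"
    unfolding eq by (simp_all add: Re_divide Im_divide d_def)
  then have "Re (1 - u) > 0" using \<open>d > 0\<close> \<open>Re \<zeta> > 0\<close> by simp
  then have "Arg (1 - u) = arctan (Im (1 - u) / Re (1 - u))" by (rule arg_conv_arctan)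
  also have "Im (1 - u) / Re (1 - u) = - Im \<zeta> / (Re \<zeta> + 1)"
    unfolding parts using \<open>d > 0\<close> \<open>Re \<zeta> > 0\<close> by (simp add: field_simps)
  finally show ?thesis by (simp add: \<zeta>_def)
qed

lemma slope_set_singleton:
  assumes lim: "((\<lambda>t. Arg (1 - cnj \<tau> * \<gamma> t)) \<longlongrightarrow> \<theta>) at_top" and "\<theta> \<in> {- pi / 2..pi / 2}"
  shows "slope_set \<gamma> \<tau> = {\<theta>}"
proof -
  have "\<theta>' = \<theta>" if "\<theta>' \<in> slope_set \<gamma> \<tau>" for \<theta>'
  proof -
    from that obtain s :: "nat \<Rightarrow> real" where s: "filterlim s at_top sequentially"
      "(\<lambda>n. Arg (1 - cnj \<tau> * \<gamma> (s n))) \<longlonglongrightarrow> \<theta>'"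
      unfolding slope_set_def by blast
    show ?thesis using LIMSEQ_unique[OF s(2) filterlim_compose[OF lim s(1)]] .
  qed
  moreover have "\<theta> \<in> slope_set \<gamma> \<tau>"
    unfolding slope_set_def using assms(2) filterlim_compose[OF lim filterlim_real_sequentially]
    by (auto intro!: exI[of _ real] filterlim_real_sequentially)
  ultimately show ?thesis by blast
qed

text \<open>Otherwise the inverse map would be a bounded entire function.\<close>
lemma univalent_image_not_UNIV:
  assumes "h holomorphic_on ball 0 1" "inj_on h (ball 0 1)"
  shows "\<exists>w. w \<notin> h ` ball 0 1"
proof (rule ccontr)
  assume "\<not> ?thesis"
  then have all: "h ` ball 0 1 = UNIV" by auto
  obtain g where g: "g holomorphic_on UNIV" "\<And>z. z \<in> ball 0 1 \<Longrightarrow> g (h z) = z"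
    using holomorphic_has_inverse[OF assms(1) open_ball assms(2)] all by metis
  have "range g \<subseteq> ball 0 1"
  proof
    fix w assume "w \<in> range g"
    then obtain v where "w = g v" by auto
    moreover obtain z where "z \<in> ball 0 1" "v = h z" using all by (metis UNIV_I imageE)
    ultimately show "w \<in> ball 0 1" using g(2) by simp
  qed
  then have "bounded (range g)" using bounded_subset bounded_ball by blast
  then have "g constant_on UNIV" using Liouville_theorem g(1) by blast
  then have "g (h 0) = g (h (1 / 2))" by (auto simp: constant_on_def)
  then show False using g(2)[of 0] g(2)[of "1/2"] by (simp add: norm_divide)
qed

theorem theorem5p4:
  fixes \<phi> :: "real \<Rightarrow> complex \<Rightarrow> complex" and \<tau> :: complex and h :: "complex \<Rightarrow> complex"
    and \<Omega> :: "complex set" and p :: complex and \<alpha>l \<alpha>r \<eta> :: real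
  assumes "disk_semigroup \<phi>" and "non_elliptic \<phi>"
    and "denjoy_wolff_point \<phi> \<tau>"
    and "koenigs_function \<phi> h"
    and "\<Omega> = h ` \<bbbD>"
    and "p \<in> natural_points \<Omega>"
    and "(left_angular_extent \<Omega> p \<longlongrightarrow> \<alpha>l) at_top"
    and "(right_angular_extent \<Omega> p \<longlongrightarrow> \<alpha>r) at_top"
    and "\<alpha>l > 0" and "\<alpha>r > 0"
    and "\<eta> = (\<alpha>l - \<alpha>r) / (\<alpha>l + \<alpha>r)"
  shows "\<forall>z\<in>\<bbbD>. slope_set (\<lambda>t. \<phi> t z) \<tau> = {\<eta> * (pi / 2)}
           \<and> converges_nontangentially (\<lambda>t. \<phi> t z) \<tau>
           \<and> converges_with_definite_slope (\<lambda>t. \<phi> t z) \<tau>"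
proof
  fix z assume z: "z \<in> \<bbbD>"
  have h: "h holomorphic_on \<bbbD>" "inj_on h \<bbbD>"
    and h\<phi>: "\<And>t z. t \<ge> 0 \<Longrightarrow> z \<in> \<bbbD> \<Longrightarrow> h (\<phi> t z) = h z + \<i> * of_real t"
    using assms(4) by (auto simp: koenigs_function_def)
  have \<phi>_disk: "\<phi> t u \<in> \<bbbD>" if "t \<ge> 0" "u \<in> \<bbbD>" for t u
    using assms(1) that unfolding disk_semigroup_def by blast
  have \<tau>: "norm \<tau> = 1" and conv: "((\<lambda>t. \<phi> t z) \<longlongrightarrow> \<tau>) at_top"
    using assms(3) z by (auto simp: denjoy_wolff_point_def)
  have \<tau>\<tau>: "cnj \<tau> * \<tau> = 1" "\<tau> * cnj \<tau> = 1" using \<tau> complex_norm_square[of \<tau>] by (simp_all add: mult.commute)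
  obtain g where g: "g holomorphic_on \<Omega>" "\<And>u. u \<in> \<bbbD> \<Longrightarrow> g (h u) = u"
    using holomorphic_has_inverse[OF h(1) open_ball h(2)] assms(5) by metis
  have g_disk: "norm (cnj \<tau> * g w) < 1" if "w \<in> \<Omega>" for w
    using that g(2) assms(5) \<tau> by (auto simp: norm_mult)
  obtain w0 where w0: "w0 \<notin> \<Omega>" using univalent_image_not_UNIV[OF h] assms(5) by auto
  obtain t0 where t0: "\<And>t. t > t0 \<Longrightarrow> p + \<i> * of_real t \<in> \<Omega>"
    using assms(6) by (auto simp: natural_points_def)
  \<comment> \<open>The rotation by \<open>cnj \<tau>\<close> followed by the Cayley transform sends \<open>\<tau>\<close> to infinity.\<close>
  define \<psi> where "\<psi> = (\<lambda>w. disk_to_hp 1 (cnj \<tau> * g w))"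
  define F where "F = (\<lambda>\<zeta>. h (\<tau> * hp_to_disk 1 \<zeta>))"
  have inner: "\<tau> * hp_to_disk 1 \<zeta> \<in> \<bbbD>" if "Re \<zeta> > 0" for \<zeta>
    using norm_hp_to_disk[of 1 \<zeta>] that \<tau> by (simp add: norm_mult)
  interpret koenigs_domain \<Omega> \<psi> F "h z" p w0 \<alpha>l \<alpha>r
  proof
    show "open \<Omega>" using open_mapping_thm3[OF h(1) open_ball h(2)] assms(5) by simp
    show "w + \<i> * of_real t \<in> \<Omega>" if w: "w \<in> \<Omega>" and "t \<ge> 0" for w t
    proof -
      obtain u where "u \<in> \<bbbD>" "w = h u" using w assms(5) by auto
      then have "h (\<phi> t u) = w + \<i> * of_real t" using h\<phi> \<open>t \<ge> 0\<close> by simp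
      then show ?thesis unfolding assms(5) using \<phi>_disk[OF \<open>t \<ge> 0\<close> \<open>u \<in> \<bbbD>\<close>] by (metis imageI)
    qed
    show "h z \<in> \<Omega>" using z assms(5) by simp
    show "\<psi> holomorphic_on \<Omega>" unfolding \<psi>_def
      by (intro holomorphic_on_disk_to_hp holomorphic_intros g g_disk)
    show "Re (\<psi> w) > 0" if "w \<in> \<Omega>" for w
      unfolding \<psi>_def using g_disk[OF that] by (intro Re_disk_to_hp) auto
    have "(\<lambda>\<zeta>. \<tau> * hp_to_disk 1 \<zeta>) holomorphic_on {\<zeta>. Re \<zeta> > 0}"
      by (intro holomorphic_intros holomorphic_on_hp_to_disk) auto
    then show "F holomorphic_on {\<zeta>. Re \<zeta> > 0}" unfolding F_def
      by (rule holomorphic_on_compose_gen[OF _ h(1), unfolded o_def]) (use inner in auto)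
    show "F \<zeta> \<in> \<Omega>" if "Re \<zeta> > 0" for \<zeta> using inner[OF that] assms(5) by (simp add: F_def)
    show "F (\<psi> w) = w" if w: "w \<in> \<Omega>" for w
    proof -
      obtain u where u: "u \<in> \<bbbD>" "w = h u" using w assms(5) by auto
      have "F (\<psi> w) = h (\<tau> * (cnj \<tau> * g w))"
        using g_disk[OF w] by (simp add: F_def \<psi>_def hp_to_disk_to_hp)
      also have "\<dots> = w" using u g(2) \<tau>\<tau> by (simp flip: mult.assoc)
      finally show ?thesis .
    qed
    show "\<forall>\<^sub>F t in at_top. p + \<i> * of_real t \<in> \<Omega>"
      using eventually_gt_at_top[of t0] by eventually_elim (rule t0)
  qed (use assms w0 in auto)
  have orbit: "\<forall>\<^sub>F t in at_top. \<psi> (h z + \<i> * of_real t) = disk_to_hp 1 (cnj \<tau> * \<phi> t z)"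
    using eventually_ge_at_top[of 0]
  proof eventually_elim
    case (elim t)
    then have "g (h z + \<i> * of_real t) = \<phi> t z"
      using g(2)[OF \<phi>_disk[OF elim z]] h\<phi>[OF elim z] by simp
    then show ?case by (simp add: \<psi>_def)
  qed
  have u_lim: "((\<lambda>t. cnj \<tau> * \<phi> t z) \<longlongrightarrow> 1) at_top"
    using tendsto_mult_left[OF conv, of "cnj \<tau>"] \<tau>\<tau> by simp
  have u_disk: "norm (cnj \<tau> * \<phi> t z) < 1" if "t \<ge> 0" for t
    using \<phi>_disk[OF that z] \<tau> by (simp add: norm_mult)
  have "filterlim (\<lambda>t. norm (\<psi> (h z + \<i> * of_real t))) at_top at_top"
  proof -
    have "((\<lambda>t. norm (1 - cnj \<tau> * \<phi> t z) / norm (1 + cnj \<tau> * \<phi> t z)) \<longlongrightarrow> norm (1 - 1 :: complex) / norm (1 + 1 :: complex)) at_top"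
      by (intro tendsto_intros u_lim) auto
    then have "((\<lambda>t. norm (1 - cnj \<tau> * \<phi> t z) / norm (1 + cnj \<tau> * \<phi> t z)) \<longlongrightarrow> 0) at_top" by simp
    moreover have "\<forall>\<^sub>F t in at_top. norm (1 - cnj \<tau> * \<phi> t z) / norm (1 + cnj \<tau> * \<phi> t z) > 0"
      using eventually_ge_at_top[of 0]
    proof eventually_elim
      case (elim t)
      have "1 - cnj \<tau> * \<phi> t z \<noteq> 0" "1 + cnj \<tau> * \<phi> t z \<noteq> 0"
        using u_disk[OF elim] by (auto simp: add_eq_0_iff)
      then show ?case by simp
    qed
    ultimately have "filterlim (\<lambda>t. inverse (norm (1 - cnj \<tau> * \<phi> t z) / norm (1 + cnj \<tau> * \<phi> t z))) at_top at_top"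
      by (rule filterlim_inverse_at_top)
    then show ?thesis
      by (rule filterlim_mono_eventually)
         (use orbit in \<open>auto elim!: eventually_mono simp: disk_to_hp_def norm_divide\<close>)
  qed
  note ray = vertical_ray_slope[OF this]
  define \<zeta> where "\<zeta> = (\<lambda>t. \<psi> (h z + \<i> * of_real t))"
  have "((\<lambda>t. 1 + 1 / Re (\<zeta> t)) \<longlongrightarrow> 1 + 0) at_top"
    unfolding \<zeta>_def by (intro tendsto_intros tendsto_divide_0[OF tendsto_const] filterlim_at_top_imp_at_infinity ray)
  then have "((\<lambda>t. - (Im (\<zeta> t) / Re (\<zeta> t)) / (1 + 1 / Re (\<zeta> t))) \<longlongrightarrow> - tan (strip_angle \<alpha>l \<alpha>r) / 1) at_top"
    using ray(2) unfolding \<zeta>_def by (intro tendsto_intros) auto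
  then have "((\<lambda>t. arctan (- (Im (\<zeta> t) / Re (\<zeta> t)) / (1 + 1 / Re (\<zeta> t)))) \<longlongrightarrow> arctan (- tan (strip_angle \<alpha>l \<alpha>r))) at_top"
    by (intro tendsto_arctan) simp
  moreover have "arctan (- tan (strip_angle \<alpha>l \<alpha>r)) = - strip_angle \<alpha>l \<alpha>r"
    using abs_strip_angle[OF ab] by (simp add: arctan_minus arctan_tan abs_less_iff)
  moreover have "- strip_angle \<alpha>l \<alpha>r = \<eta> * (pi / 2)"
    using ab by (simp add: strip_angle_def strip_exponent_def assms(11) field_simps)
  moreover have "\<forall>\<^sub>F t in at_top. arctan (- (Im (\<zeta> t) / Re (\<zeta> t)) / (1 + 1 / Re (\<zeta> t))) = Arg (1 - cnj \<tau> * \<phi> t z)"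
    using orbit eventually_ge_at_top[of 0]
  proof eventually_elim
    case (elim t)
    have "Re (\<zeta> t) > 0" unfolding \<zeta>_def by (intro \<psi>_pos up c elim)
    then have "1 + 1 / Re (\<zeta> t) = (Re (\<zeta> t) + 1) / Re (\<zeta> t)" by (simp add: field_simps)
    then have "- (Im (\<zeta> t) / Re (\<zeta> t)) / (1 + 1 / Re (\<zeta> t)) = - Im (\<zeta> t) / (Re (\<zeta> t) + 1)"
      using \<open>Re (\<zeta> t) > 0\<close> by simp
    moreover have "\<zeta> t = disk_to_hp 1 (cnj \<tau> * \<phi> t z)" using elim(1) by (simp add: \<zeta>_def)
    ultimately show ?case using Arg_one_minus_disk[OF u_disk[OF elim(2)]] by (simp only:)
  qed
  ultimately have lim: "((\<lambda>t. Arg (1 - cnj \<tau> * \<phi> t z)) \<longlongrightarrow> \<eta> * (pi / 2)) at_top"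
    using Lim_transform_eventually by force
  have range: "\<bar>\<eta> * (pi / 2)\<bar> < pi / 2"
    using abs_strip_angle[OF ab] \<open>- strip_angle \<alpha>l \<alpha>r = \<eta> * (pi / 2)\<close> by (metis abs_minus_cancel)
  then have slope: "slope_set (\<lambda>t. \<phi> t z) \<tau> = {\<eta> * (pi / 2)}"
    by (intro slope_set_singleton lim) (auto simp: abs_less_iff)
  have "converges_nontangentially (\<lambda>t. \<phi> t z) \<tau>"
    unfolding converges_nontangentially_def slope using conv range by (auto simp: abs_less_iff)
  moreover have "converges_with_definite_slope (\<lambda>t. \<phi> t z) \<tau>"
    unfolding converges_with_definite_slope_def slope using conv by blast
  ultimately show "slope_set (\<lambda>t. \<phi> t z) \<tau> = {\<eta> * (pi / 2)}
           \<and> converges_nontangentially (\<lambda>t. \<phi> t z) \<tau>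
           \<and> converges_with_definite_slope (\<lambda>t. \<phi> t z) \<tau>"
    using slope by blast
qed

end
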